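(* Let $\lambda:[0,\infty)\to\mathbb{C}$ be a bounded function and let $1\le p,q\le\infty$. Let $\Lambda_*$ be the multiplier operator on $\Omega_d$ associated with the sequence $\lambda^*_{m,n}=\lambda(m+n)$, $m,n\in\mathbb{N}$, and let $\widetilde\Lambda$ be the multiplier operator on $S^{2d-1}$ associated with the sequence $\lambda_k=\lambda(k)$, $k\in\mathbb{N}$. Suppose that $\Lambda_*$ is bounded from $L^p(\Omega_d)$ to $L^q(\Omega_d)$. Then for every $n\in\mathbb{N}$ $$d_n(\Lambda_*U_p,L^q(\Omega_d))=d_n(\widetilde\Lambda\widetilde U_p,L^q(S^{2d-1})),\qquad d^n(\Lambda_*U_p,L^q(\Omega_d))=d^n(\widetilde\Lambda\widetilde U_p,L^q(S^{2d-1})),$$ $$\delta_n(\Lambda_*U_p,L^q(\Omega_d))=\delta_n(\widetilde\Lambda\widetilde U_p,L^q(S^{2d-1})),\qquad b_n(\Lambda_*U_p,L^q(\Omega_d))=b_n(\widetilde\Lambda\widetilde U_p,L^q(S^{2d-1})).$$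
   Context: $\mathbb{N}=\{0,1,2,\dots\}$ and $d\ge 2$ is a fixed integer. $S^{2d-1}$ is the unit sphere of $\mathbb{R}^{2d}$ with Lebesgue surface measure $\tau_{2d}$ (not normalized); $\Omega_d=\{z\in\mathbb{C}^d:\langle z,z\rangle=1\}$; $\Upsilon:\Omega_d\to S^{2d-1}$ is $\Upsilon(z)=(x_1,y_1,\dots,x_d,y_d)$ where $z_k=x_k+iy_k$; and $\sigma_d(E)=\tau_{2d}(\Upsilon(E))$. $L^p(\Omega_d)$, $L^p(S^{2d-1})$ are the usual spaces of complex-valued functions with respect to $\sigma_d$, $\tau_{2d}$, with closed unit balls $U_p$, $\widetilde U_p$. Harmonics. $\mathcal{H}_k\subset L^2(S^{2d-1})$ is the space of spherical harmonics of degree $k$ (restrictions to the sphere of harmonic homogeneous polynomials of degree $k$). $\mathcal{H}_{m,n}\subset L^2(\Omega_d)$ is the space of restrictions to $\Omega_d$ of the polynomials in $z,\bar z$ that are homogeneous of degree $m$ in $z$ and of degree $n$ in $\bar z$ and lie in the kernel of $4\sum_{j=1}^d\partial^2/\partial z_j\partial\bar z_j$. For $w\in\Omega_d$, $Z_w^{(m,n)}\in\mathcal{H}_{m,n}$ is the reproducing kernel: $Y(w)=\int_{\Omega_d}Y\,\overline{Z_w^{(m,n)}}\,d\sigma_d$ for $Y\in\mathcal{H}_{m,n}$; similarly $Z_x^{(k)}$ (real-valued) for $\mathcal{H}_k$, $x\in S^{2d-1}$. For integrable $\varphi$ put $(\varphi*\widetilde Z^{(m,n)})(w)=\int_{\Omega_d}\varphi\,\overline{Z_w^{(m,n)}}\,d\sigma_d$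 and $(\varphi*\widetilde Z^{(k)})(x)=\int_{S^{2d-1}}\varphi\, Z_x^{(k)}\,d\tau_{2d}$; on $L^2$ these are the orthogonal projections onto $\mathcal{H}_{m,n}$ and $\mathcal{H}_k$. Multipliers. For a sequence $\Lambda=\{\lambda_{m,n}\}$, the multiplier operator $\Lambda$ is bounded from $L^p(\Omega_d)$ to $L^q(\Omega_d)$ if for every $\varphi\in L^p(\Omega_d)$ there is $f=\Lambda\varphi\in L^q(\Omega_d)$ with formal expansion $f\sim\sum_{m,n}\lambda_{m,n}\,\varphi*\widetilde Z^{(m,n)}$ (i.e. $f*\widetilde Z^{(m,n)}=\lambda_{m,n}\varphi*\widetilde Z^{(m,n)}$ for all $m,n$), and $\sup_{\varphi\in U_p}\|\Lambda\varphi\|_q<\infty$. Multiplier operators on $S^{2d-1}$ associated with sequences $\{\lambda_k\}$ are defined in the same way with $\varphi*\widetilde Z^{(k)}$. Widths. For a convex centrally symmetric subset $A$ of a Banach space $X$ with closed unit ball $B_X$: Kolmogorov width $d_n(A,X)=\inf_{X_n}\sup_{x\in A}\inf_{y\in X_n}\|x-y\|$ ($X_n$ over subspaces of dimension $n$); linear width $\delta_n(A,X)=\inf_{P_n}\sup_{x\in A}\|x-P_nx\|$ ($P_n$ over bounded linear operators on $X$ with range of dimension $n$); Gelfand width $d^n(A,X)=\inf_{L^n}\sup_{x\in A\cap L^n}\|x\|$ ($L^n$ over subspaces of codimension $n$); Bernstein width $b_n(A,X)=\sup_{X_{n+1}}\sup\{\lambda:\lambda B_X\cap X_{n+1}\subseteq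 A\}$ ($X_{n+1}$ over subspaces of dimension $n+1$). *)

theory Defs
  imports "HOL-Analysis.Analysis" "HOL-Probability.Essential_Supremum"
begin

text \<open>
  The spaces \<open>L\<^sup>p(M)\<close> depend on the values \<open>M\<close> and \<open>p\<close>, so they are not types; a complex normed
  space is therefore given here by a carrier together with its operations.
\<close>

record 'v normed_sp =
  vecs :: "'v set"
  vzero :: "'v"
  vadd :: "'v \<Rightarrow> 'v \<Rightarrow> 'v"
  vscale :: "complex \<Rightarrow> 'v \<Rightarrow> 'v"
  vnorm :: "'v \<Rightarrow> real"

definition vdiff :: "'v normed_sp \<Rightarrow> 'v \<Rightarrow> 'v \<Rightarrow> 'v" where
  "vdiff X x y = vadd X x (vscale X (-1) y)"

definition unit_ball :: "'v normed_sp \<Rightarrow> 'v set" where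
  "unit_ball X = {x \<in> vecs X. vnorm X x \<le> 1}"

definition subspace_of :: "'v normed_sp \<Rightarrow> 'v set \<Rightarrow> bool" where
  "subspace_of X V \<longleftrightarrow> V \<subseteq> vecs X \<and> vzero X \<in> V \<and>
     (\<forall>x\<in>V. \<forall>y\<in>V. vadd X x y \<in> V) \<and> (\<forall>c. \<forall>x\<in>V. vscale X c x \<in> V)"

definition span_in :: "'v normed_sp \<Rightarrow> 'v set \<Rightarrow> 'v set" where
  "span_in X B = subspace_of X hull B"

definition independent_in :: "'v normed_sp \<Rightarrow> 'v set \<Rightarrow> bool" where
  "independent_in X B \<longleftrightarrow> (\<forall>b\<in>B. b \<notin> span_in X (B - {b}))"

definition subspace_dim :: "'v normed_sp \<Rightarrow> nat \<Rightarrow> 'v set \<Rightarrow> bool" where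
  "subspace_dim X n V \<longleftrightarrow> subspace_of X V \<and>
     (\<exists>B\<subseteq>V. finite B \<and> card B = n \<and> independent_in X B \<and> span_in X B = V)"

text \<open>Codimension is the algebraic one; the subspace is not required to be closed.\<close>

definition subspace_codim :: "'v normed_sp \<Rightarrow> nat \<Rightarrow> 'v set \<Rightarrow> bool" where
  "subspace_codim X n L \<longleftrightarrow> subspace_of X L \<and>
     (\<exists>W. subspace_dim X n W \<and> L \<inter> W = {vzero X} \<and>
          (\<forall>x\<in>vecs X. \<exists>u\<in>L. \<exists>w\<in>W. x = vadd X u w))"

definition bounded_linear_op :: "'v normed_sp \<Rightarrow> ('v \<Rightarrow> 'v) \<Rightarrow> bool" where
  "bounded_linear_op X P \<longleftrightarrow>
     (\<forall>x\<in>vecs X. P x \<in> vecs X) \<and>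
     (\<forall>x\<in>vecs X. \<forall>y\<in>vecs X. P (vadd X x y) = vadd X (P x) (P y)) \<and>
     (\<forall>c. \<forall>x\<in>vecs X. P (vscale X c x) = vscale X c (P x)) \<and>
     (\<exists>C. \<forall>x\<in>vecs X. vnorm X (P x) \<le> C * vnorm X x)"

definition kolmogorov_width :: "nat \<Rightarrow> 'v set \<Rightarrow> 'v normed_sp \<Rightarrow> ennreal" where
  "kolmogorov_width n A X =
     (INF V\<in>{V. subspace_dim X n V}. SUP x\<in>A. INF y\<in>V. ennreal (vnorm X (vdiff X x y)))"

definition linear_width :: "nat \<Rightarrow> 'v set \<Rightarrow> 'v normed_sp \<Rightarrow> ennreal" where
  "linear_width n A X =
     (INF P\<in>{P. bounded_linear_op X P \<and> subspace_dim X n (P ` vecs X)}.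
        SUP x\<in>A. ennreal (vnorm X (vdiff X x (P x))))"

definition gelfand_width :: "nat \<Rightarrow> 'v set \<Rightarrow> 'v normed_sp \<Rightarrow> ennreal" where
  "gelfand_width n A X =
     (INF L\<in>{L. subspace_codim X n L}. SUP x\<in>A \<inter> L. ennreal (vnorm X x))"

definition bernstein_width :: "nat \<Rightarrow> 'v set \<Rightarrow> 'v normed_sp \<Rightarrow> ennreal" where
  "bernstein_width n A X =
     (SUP V\<in>{V. subspace_dim X (n + 1) V}.
        SUP l\<in>{l::real. 0 \<le> l \<and> vscale X (of_real l) ` unit_ball X \<inter> V \<subseteq> A}. ennreal l)"

definition Lp_fun :: "'a measure \<Rightarrow> ennreal \<Rightarrow> ('a \<Rightarrow> complex) set" where
  "Lp_fun M p = {f \<in> borel_measurable M.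
     if p = \<infinity> then esssup M (\<lambda>x. ennreal (cmod (f x))) < \<infinity>
     else integrable M (\<lambda>x. cmod (f x) powr enn2real p)}"

definition Lp_norm :: "'a measure \<Rightarrow> ennreal \<Rightarrow> ('a \<Rightarrow> complex) \<Rightarrow> real" where
  "Lp_norm M p f =
     (if p = \<infinity> then enn2real (esssup M (\<lambda>x. ennreal (cmod (f x))))
      else (LINT x|M. cmod (f x) powr enn2real p) powr (1 / enn2real p))"

definition ae_eq :: "'a measure \<Rightarrow> ennreal \<Rightarrow> (('a \<Rightarrow> complex) \<times> ('a \<Rightarrow> complex)) set" where
  "ae_eq M p = {(f, g). f \<in> Lp_fun M p \<and> g \<in> Lp_fun M p \<and> (AE x in M. f x = g x)}"

definition ae_class :: "'a measure \<Rightarrow> ennreal \<Rightarrow> ('a \<Rightarrow> complex) \<Rightarrow> ('a \<Rightarrow> complex) set" where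
  "ae_class M p f = ae_eq M p `` {f}"

text \<open>The operations below do not depend on the choice of representatives.\<close>

definition rep :: "('a \<Rightarrow> complex) set \<Rightarrow> 'a \<Rightarrow> complex" where
  "rep F = (SOME f. f \<in> F)"

definition Lp :: "'a measure \<Rightarrow> ennreal \<Rightarrow> ('a \<Rightarrow> complex) set normed_sp" where
  "Lp M p =
     \<lparr> vecs = Lp_fun M p // ae_eq M p,
       vzero = ae_class M p (\<lambda>x. 0),
       vadd = (\<lambda>F G. ae_class M p (\<lambda>x. rep F x + rep G x)),
       vscale = (\<lambda>c F. ae_class M p (\<lambda>x. c * rep F x)),
       vnorm = (\<lambda>F. Lp_norm M p (rep F)) \<rparr>"

text \<open>
  The unnormalized surface measure of the unit sphere: \<open>N\<close> times the Lebesgue measure of the cone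
  \<open>{t x | 0 < t \<le> 1, x \<in> E}\<close>, where \<open>N\<close> is the dimension of the ambient space.
\<close>

definition cone_over :: "'e::euclidean_space set \<Rightarrow> 'e set" where
  "cone_over E = {t *\<^sub>R x | t x. 0 < t \<and> t \<le> 1 \<and> x \<in> E}"

definition surface_measure :: "'e::euclidean_space measure" where
  "surface_measure =
     measure_of (sphere 0 1) (sets (restrict_space borel (sphere 0 1)))
       (\<lambda>E. of_nat DIM('e) * emeasure lborel (cone_over E))"

lemma cone_over_eq_vimage:
  fixes E :: "'e::euclidean_space set"
  assumes "E \<subseteq> sphere 0 1"
  shows "cone_over E = (\<lambda>x. x /\<^sub>R norm x) -` E \<inter> (cball 0 1 - {0})"
proof (intro equalityI subsetI)
  fix y assume "y \<in> (\<lambda>x. x /\<^sub>R norm x) -` E \<inter> (cball 0 1 - {0})"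
  then have "y = norm y *\<^sub>R (y /\<^sub>R norm y)" "0 < norm y" "norm y \<le> 1" "y /\<^sub>R norm y \<in> E"
    by auto
  then show "y \<in> cone_over E"
    unfolding cone_over_def by blast
next
  fix y assume "y \<in> cone_over E"
  then obtain t x where tx: "y = t *\<^sub>R x" "0 < t" "t \<le> 1" "x \<in> E"
    by (auto simp: cone_over_def)
  with assms have "norm x = 1" by auto
  with tx show "y \<in> (\<lambda>x. x /\<^sub>R norm x) -` E \<inter> (cball 0 1 - {0})"
    by auto
qed

lemma sets_cone_over:
  fixes E :: "'e::euclidean_space set"
  assumes "E \<in> sets (restrict_space borel (sphere 0 1))"
  shows "cone_over E \<in> sets borel"
proof -
  from assms have E: "E \<subseteq> sphere 0 1" "E \<in> sets borel"
    by (auto simp: sets_restrict_space_iff)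
  have "(\<lambda>x::'e. x /\<^sub>R norm x) \<in> borel_measurable borel"
    by measurable
  from measurable_sets[OF this E(2)] show ?thesis
    unfolding cone_over_eq_vimage[OF E(1)] by auto
qed

lemma space_surface_measure [simp]: "space surface_measure = sphere 0 1"
  unfolding surface_measure_def
  by (rule space_measure_of) (auto simp: sets_restrict_space)

lemma sets_surface_measure:
  "sets (surface_measure :: 'e::euclidean_space measure) = sets (restrict_space borel (sphere 0 1))"
  unfolding surface_measure_def
  using sets.sigma_sets_eq[of "restrict_space borel (sphere 0 1) :: 'e measure"]
    sets.space_closed[of "restrict_space borel (sphere 0 1) :: 'e measure"]
  by (metis Int_UNIV_right sets_measure_of space_borel space_restrict_space)

lemma emeasure_surface_measure:
  fixes E :: "'e::euclidean_space set"
  assumes "E \<in> sets (restrict_space borel (sphere 0 1))"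
  shows "emeasure surface_measure E = of_nat DIM('e) * emeasure lborel (cone_over E)"
proof (rule emeasure_measure_of[OF surface_measure_def])
  let ?R = "restrict_space borel (sphere 0 1) :: 'e measure"
  show "sets ?R \<subseteq> Pow (sphere 0 1)"
    using sets.space_closed[of ?R] by (simp add: space_restrict_space)
  show "E \<in> sets surface_measure"
    using assms by (simp add: sets_surface_measure)
  show "positive (sets (surface_measure :: 'e measure)) (\<lambda>E. of_nat DIM('e) * emeasure lborel (cone_over E))"
    by (simp add: positive_def cone_over_def)
  show "countably_additive (sets (surface_measure :: 'e measure))
      (\<lambda>E. of_nat DIM('e) * emeasure lborel (cone_over E))"
  proof (rule countably_additiveI)
    fix A :: "nat \<Rightarrow> 'e set"
    assume A: "range A \<subseteq> sets surface_measure" "disjoint_family A"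
    then have A': "A i \<in> sets ?R" for i
      by (auto simp: sets_surface_measure)
    then have sub: "A i \<subseteq> sphere 0 1" for i
      by (auto simp: sets_restrict_space_iff)
    have U: "cone_over (\<Union> (range A)) = (\<Union>i. cone_over (A i))"
      unfolding cone_over_def by blast
    have "disjoint_family (\<lambda>i. cone_over (A i))"
      using A(2) by (auto simp: disjoint_family_on_def cone_over_eq_vimage[OF sub])
    then have "(\<Sum>i. emeasure lborel (cone_over (A i))) = emeasure lborel (\<Union>i. cone_over (A i))"
      by (intro suminf_emeasure) (auto simp: sets_cone_over[OF A'])
    then show "(\<Sum>i. of_nat DIM('e) * emeasure lborel (cone_over (A i))) =
        of_nat DIM('e) * emeasure lborel (cone_over (\<Union> (range A)))"
      unfolding ennreal_suminf_cmult U by simp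
  qed
qed

text \<open>
  Coordinates of \<open>\<real>\<^sup>2\<^sup>d\<close> are indexed by pairs: \<open>(k, 1)\<close> is the place of \<open>x\<^sub>k\<close> and \<open>(k, 2)\<close> that of
  \<open>y\<^sub>k\<close>.
\<close>

definition Upsilon :: "complex ^ 'd \<Rightarrow> real ^ ('d \<times> 2)" where
  "Upsilon z = (\<chi> ki. if snd ki = 1 then Re (z $ fst ki) else Im (z $ fst ki))"

definition Omega :: "(complex ^ 'd) set" where
  "Omega = {z. (\<Sum>k\<in>UNIV. z $ k * cnj (z $ k)) = 1}"

definition sigma_Omega :: "(complex ^ 'd) measure" where
  "sigma_Omega = measure_of Omega (sets (restrict_space borel Omega))
     (\<lambda>E. emeasure surface_measure (Upsilon ` E))"

lemma inj_Upsilon: "inj Upsilon"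
proof (rule injI)
  fix z w :: "complex ^ 'd" assume eq: "Upsilon z = Upsilon w"
  show "z = w"
  proof (rule vec_eq_iff[THEN iffD2], rule allI)
    fix k
    from eq have "Upsilon z $ (k, 1) = Upsilon w $ (k, 1)" "Upsilon z $ (k, 2) = Upsilon w $ (k, 2)"
      by auto
    then show "z $ k = w $ k"
      by (simp add: Upsilon_def complex_eq_iff)
  qed
qed

lemma Upsilon_image_eq_vimage:
  fixes E :: "(complex ^ 'd) set"
  shows "Upsilon ` E = (\<lambda>x. \<chi> k. Complex (x $ (k, 1)) (x $ (k, 2))) -` E"
proof -
  define g :: "real ^ ('d \<times> 2) \<Rightarrow> complex ^ 'd"
    where "g = (\<lambda>x. \<chi> k. Complex (x $ (k, 1)) (x $ (k, 2)))"
  have gU: "g (Upsilon z) = z" for z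
    by (simp add: g_def Upsilon_def vec_eq_iff)
  have Ug: "Upsilon (g x) = x" for x
  proof (rule vec_eq_iff[THEN iffD2], rule allI)
    fix ki :: "'d \<times> 2"
    have "snd ki = 1 \<or> snd ki = 2" by (rule exhaust_2)
    then show "Upsilon (g x) $ ki = x $ ki"
      by (cases ki) (auto simp: g_def Upsilon_def)
  qed
  have "Upsilon ` E = g -` E"
    proof (intro equalityI subsetI)
    fix x assume "x \<in> g -` E"
    then show "x \<in> Upsilon ` E" by (intro image_eqI[of _ _ "g x"]) (auto simp: Ug)
  qed (auto simp: gU)
  then show ?thesis by (simp add: g_def)
qed

lemma Upsilon_image_Omega: "Upsilon ` (Omega :: (complex ^ 'd) set) = sphere 0 1"
proof -
  have n: "(norm (Upsilon z))\<^sup>2 = (\<Sum>k\<in>UNIV. (cmod (z $ k))\<^sup>2)" for z :: "complex ^ 'd"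
  proof -
    have "(norm (Upsilon z))\<^sup>2 = (\<Sum>ki\<in>UNIV. (Upsilon z $ ki)\<^sup>2)"
      by (simp add: norm_vec_def L2_set_def sum_nonneg)
    also have "\<dots> = (\<Sum>k\<in>UNIV. \<Sum>i\<in>UNIV. (Upsilon z $ (k, i))\<^sup>2)"
      by (simp add: sum.cartesian_product flip: UNIV_Times_UNIV)
    also have "\<dots> = (\<Sum>k\<in>UNIV. (cmod (z $ k))\<^sup>2)"
      by (simp add: UNIV_2 Upsilon_def cmod_power2 add.commute)
    finally show ?thesis .
  qed
  have "z \<in> Omega \<longleftrightarrow> (norm (Upsilon z))\<^sup>2 = 1" for z :: "complex ^ 'd"
  proof -
    have "(\<Sum>k\<in>UNIV. z $ k * cnj (z $ k)) = of_real ((norm (Upsilon z))\<^sup>2)"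
      unfolding n of_real_sum by (intro sum.cong refl complex_norm_square[symmetric])
    then show ?thesis
      unfolding Omega_def mem_Collect_eq by (simp only: of_real_eq_1_iff)
  qed
  moreover have "r\<^sup>2 = 1 \<longleftrightarrow> r = 1" if "0 \<le> r" for r :: real
    using that power2_eq_1_iff[of r] by auto
  ultimately have *: "z \<in> Omega \<longleftrightarrow> Upsilon z \<in> sphere 0 1" for z :: "complex ^ 'd"
    by simp
  have "surj (Upsilon :: complex ^ 'd \<Rightarrow> _)"
    using Upsilon_image_eq_vimage[of "UNIV :: (complex ^ 'd) set"] by simp
  show ?thesis
  proof (intro equalityI subsetI)
    fix x :: "real ^ ('d \<times> 2)" assume "x \<in> sphere 0 1"
    moreover obtain z :: "complex ^ 'd" where "x = Upsilon z"
      using \<open>surj Upsilon\<close> by (rule surjE)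
    ultimately show "x \<in> Upsilon ` Omega"
      using *[of z] by simp
  next
    fix x :: "real ^ ('d \<times> 2)" assume "x \<in> Upsilon ` Omega"
    then obtain z :: "complex ^ 'd" where "x = Upsilon z" "z \<in> Omega"
      by (rule imageE)
    then show "x \<in> sphere 0 1"
      using *[of z] by simp
  qed
qed

lemma sets_Upsilon_image:
  fixes E :: "(complex ^ 'd) set"
  assumes "E \<in> sets (restrict_space borel Omega)"
  shows "Upsilon ` E \<in> sets surface_measure"
proof -
  have "closed (Omega :: (complex ^ 'd) set)"
    unfolding Omega_def by (intro closed_Collect_eq continuous_intros)
  then have "Omega \<in> sets (borel :: (complex ^ 'd) measure)"
    by (rule borel_closed)
  with assms have E: "E \<in> sets borel" "E \<subseteq> Omega"
    by (auto simp: sets_restrict_space_iff)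
  have "continuous_on UNIV
      (\<lambda>x :: real ^ ('d \<times> 2). \<chi> k. Complex (x $ (k, 1)) (x $ (k, 2)))"
    unfolding Complex_eq by (intro continuous_intros)
  then have "(\<lambda>x :: real ^ ('d \<times> 2). \<chi> k. Complex (x $ (k, 1)) (x $ (k, 2))) \<in> borel_measurable borel"
    by (rule borel_measurable_continuous_onI)
  from measurable_sets[OF this E(1)] have "Upsilon ` E \<in> sets borel"
    by (simp add: Upsilon_image_eq_vimage)
  moreover have "Upsilon ` E \<subseteq> sphere 0 1"
    using E(2) Upsilon_image_Omega by blast
  ultimately show ?thesis
    by (simp add: sets_surface_measure sets_restrict_space_iff)
qed

lemma space_sigma_Omega [simp]: "space sigma_Omega = Omega"
  unfolding sigma_Omega_def
  by (rule space_measure_of) (auto simp: sets_restrict_space)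

lemma sets_sigma_Omega:
  "sets (sigma_Omega :: (complex ^ 'd) measure) = sets (restrict_space borel Omega)"
  unfolding sigma_Omega_def
  using sets.sigma_sets_eq[of "restrict_space borel Omega :: (complex ^ 'd) measure"]
    sets.space_closed[of "restrict_space borel Omega :: (complex ^ 'd) measure"]
  by (metis Int_UNIV_right sets_measure_of space_borel space_restrict_space)

lemma emeasure_sigma_Omega:
  fixes E :: "(complex ^ 'd) set"
  assumes "E \<in> sets (restrict_space borel Omega)"
  shows "emeasure sigma_Omega E = emeasure surface_measure (Upsilon ` E)"
proof (rule emeasure_measure_of[OF sigma_Omega_def])
  let ?R = "restrict_space borel Omega :: (complex ^ 'd) measure"
  show "sets ?R \<subseteq> Pow Omega"
    using sets.space_closed[of ?R] by (simp add: space_restrict_space)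
  show "E \<in> sets sigma_Omega"
    using assms by (simp add: sets_sigma_Omega)
  show "positive (sets (sigma_Omega :: (complex ^ 'd) measure)) (\<lambda>E. emeasure surface_measure (Upsilon ` E))"
    by (simp add: positive_def)
  show "countably_additive (sets (sigma_Omega :: (complex ^ 'd) measure)) (\<lambda>E. emeasure surface_measure (Upsilon ` E))"
  proof (rule countably_additiveI)
    fix A :: "nat \<Rightarrow> (complex ^ 'd) set"
    assume A: "range A \<subseteq> sets sigma_Omega" "disjoint_family A"
    then have "Upsilon ` A i \<in> sets surface_measure" for i
      by (intro sets_Upsilon_image) (auto simp: sets_sigma_Omega)
    moreover have "disjoint_family (\<lambda>i. Upsilon ` A i)"
      using A(2) inj_Upsilon unfolding disjoint_family_on_def
      by (metis image_Int image_empty)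
    ultimately have "(\<Sum>i. emeasure surface_measure (Upsilon ` A i)) =
        emeasure surface_measure (\<Union>i. Upsilon ` A i)"
      by (intro suminf_emeasure) auto
    then show "(\<Sum>i. emeasure surface_measure (Upsilon ` A i)) =
        emeasure surface_measure (Upsilon ` (\<Union> (range A)))"
      by (simp add: image_UN)
  qed
qed

definition dir_deriv :: "'e::real_normed_vector \<Rightarrow> ('e \<Rightarrow> complex) \<Rightarrow> 'e \<Rightarrow> complex" where
  "dir_deriv v f x = vector_derivative (\<lambda>t. f (x + t *\<^sub>R v)) (at 0)"

definition laplacian :: "(real ^ 'n \<Rightarrow> complex) \<Rightarrow> real ^ 'n \<Rightarrow> complex" where
  "laplacian f x = (\<Sum>i\<in>UNIV. dir_deriv (axis i 1) (dir_deriv (axis i 1) f) x)"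

definition d_z :: "'d \<Rightarrow> (complex ^ 'd \<Rightarrow> complex) \<Rightarrow> complex ^ 'd \<Rightarrow> complex" where
  "d_z j f z = (dir_deriv (axis j 1) f z - \<i> * dir_deriv (axis j \<i>) f z) / 2"

definition d_zbar :: "'d \<Rightarrow> (complex ^ 'd \<Rightarrow> complex) \<Rightarrow> complex ^ 'd \<Rightarrow> complex" where
  "d_zbar j f z = (dir_deriv (axis j 1) f z + \<i> * dir_deriv (axis j \<i>) f z) / 2"

definition complex_laplacian :: "(complex ^ 'd \<Rightarrow> complex) \<Rightarrow> complex ^ 'd \<Rightarrow> complex" where
  "complex_laplacian f z = 4 * (\<Sum>j\<in>UNIV. d_z j (d_zbar j f) z)"

text \<open>Exponent vectors are functions from the index type to \<open>nat\<close>; there are finitely many of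
  each total degree.\<close>

definition multi_indices :: "nat \<Rightarrow> ('n::finite \<Rightarrow> nat) set" where
  "multi_indices k = {\<alpha>. (\<Sum>i\<in>UNIV. \<alpha> i) = k}"

lemma finite_multi_indices: "finite (multi_indices k :: ('n::finite \<Rightarrow> nat) set)"
proof (rule finite_subset)
  show "(multi_indices k :: ('n \<Rightarrow> nat) set) \<subseteq> (UNIV :: 'n set) \<rightarrow>\<^sub>E {..k}"
  proof (auto simp: multi_indices_def)
    fix \<alpha> :: "'n \<Rightarrow> nat" and x
    show "\<alpha> x \<le> sum \<alpha> UNIV" by (rule member_le_sum) auto
  qed
qed (auto intro!: finite_PiE)

definition homogeneous_polys :: "nat \<Rightarrow> (real ^ 'n \<Rightarrow> complex) set" where
  "homogeneous_polys k = {f. \<exists>c. f =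
     (\<lambda>x. \<Sum>\<alpha>\<in>multi_indices k. c \<alpha> * (\<Prod>i\<in>UNIV. of_real (x $ i) ^ \<alpha> i))}"

definition bihomogeneous_polys :: "nat \<Rightarrow> nat \<Rightarrow> (complex ^ 'd \<Rightarrow> complex) set" where
  "bihomogeneous_polys m n = {f. \<exists>c. f =
     (\<lambda>z. \<Sum>\<alpha>\<in>multi_indices m. \<Sum>\<beta>\<in>multi_indices n.
        c \<alpha> \<beta> * (\<Prod>j\<in>UNIV. (z $ j) ^ \<alpha> j) * (\<Prod>j\<in>UNIV. cnj (z $ j) ^ \<beta> j))}"

definition sphere_harmonics :: "nat \<Rightarrow> (real ^ 'n \<Rightarrow> complex) set" where
  "sphere_harmonics k = {restrict f (sphere 0 1) | f.
     f \<in> homogeneous_polys k \<and> (\<forall>x. laplacian f x = 0)}"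

definition Omega_harmonics :: "nat \<Rightarrow> nat \<Rightarrow> (complex ^ 'd \<Rightarrow> complex) set" where
  "Omega_harmonics m n = {restrict f Omega | f.
     f \<in> bihomogeneous_polys m n \<and> (\<forall>z. complex_laplacian f z = 0)}"

definition reproducing_kernel ::
    "'a measure \<Rightarrow> ('a \<Rightarrow> complex) set \<Rightarrow> 'a \<Rightarrow> 'a \<Rightarrow> complex" where
  "reproducing_kernel M H w =
     (THE Z. Z \<in> H \<and> (\<forall>Y\<in>H. Y w = (LINT z|M. Y z * cnj (Z z))))"

text \<open>The real zonal kernel is used without conjugation, the complex one with.\<close>

definition sphere_conv :: "nat \<Rightarrow> (real ^ 'n \<Rightarrow> complex) \<Rightarrow> real ^ 'n \<Rightarrow> complex" where
  "sphere_conv k \<phi> x = (LINT y|surface_measure.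
     \<phi> y * reproducing_kernel surface_measure (sphere_harmonics k) x y)"

definition Omega_conv :: "nat \<times> nat \<Rightarrow> (complex ^ 'd \<Rightarrow> complex) \<Rightarrow> complex ^ 'd \<Rightarrow> complex" where
  "Omega_conv = (\<lambda>(m, n) \<phi> w. LINT z|sigma_Omega.
     \<phi> z * cnj (reproducing_kernel sigma_Omega (Omega_harmonics m n) w z))"

text \<open>
  A multiplier operator from \<open>L\<^sup>p(M)\<close> to \<open>L\<^sup>q(M)\<close> is represented by its graph: all pairs \<open>(\<phi>, f)\<close>
  such that \<open>f\<close> has the formal expansion \<open>\<Sum>\<^sub>i \<lambda>\<^sub>i (T\<^sub>i \<phi>)\<close>, where \<open>T\<^sub>i\<close> is the family of convolutions
  with the kernels.  On the spheres considered here the harmonics are complete, so that the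
  relation is single-valued.
\<close>

definition multiplier ::
    "'a measure \<Rightarrow> ('i \<Rightarrow> ('a \<Rightarrow> complex) \<Rightarrow> 'a \<Rightarrow> complex) \<Rightarrow> ('i \<Rightarrow> complex)
      \<Rightarrow> ennreal \<Rightarrow> ennreal \<Rightarrow> (('a \<Rightarrow> complex) set \<times> ('a \<Rightarrow> complex) set) set" where
  "multiplier M T l p q = {(\<phi>, f). \<phi> \<in> vecs (Lp M p) \<and> f \<in> vecs (Lp M q) \<and>
     (\<forall>i. \<forall>w\<in>space M. T i (rep f) w = l i * T i (rep \<phi>) w)}"

definition bounded_multiplier ::
    "'a measure \<Rightarrow> ('i \<Rightarrow> ('a \<Rightarrow> complex) \<Rightarrow> 'a \<Rightarrow> complex) \<Rightarrow> ('i \<Rightarrow> complex)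
      \<Rightarrow> ennreal \<Rightarrow> ennreal \<Rightarrow> bool" where
  "bounded_multiplier M T l p q \<longleftrightarrow>
     (\<forall>\<phi>\<in>vecs (Lp M p). \<exists>f. (\<phi>, f) \<in> multiplier M T l p q) \<and>
     bdd_above (vnorm (Lp M q) ` (multiplier M T l p q `` unit_ball (Lp M p)))"

definition Omega_multiplier where
  "Omega_multiplier = multiplier sigma_Omega Omega_conv"

definition sphere_multiplier where
  "sphere_multiplier = multiplier surface_measure sphere_conv"

end

theory Submission
  imports Defs
begin

text \<open>
  The widths of a set depend only on the isometry class of the normed space together with the set
  (locale \<open>normed_sp_iso\<close>). Composition with \<open>\<Upsilon>\<close> carries \<open>\<tau>\<close> to \<open>\<sigma>\<close>, hence is an isometric
  isomorphism of \<open>L\<^sup>p(S\<^sup>2\<^sup>d\<^sup>-\<^sup>1)\<close> onto \<open>L\<^sup>p(\<Omega>\<^sub>d)\<close> for \<open>p \<ge> 1\<close> (\<open>normed_sp_iso_pull\<close>). So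
  everything rests on the claim that this isomorphism carries the graph of the multiplier on
  the real sphere to the graph of the multiplier on the complex sphere (\<open>multiplier_pull_iff\<close>).

  On a space \<open>H\<close> of harmonics with multiplier value \<open>l\<close>, the condition \<open>f * Z = l (\<phi> * Z)\<close> says that
  \<open>f - l \<phi>\<close> is orthogonal to all reproducing kernels of \<open>H\<close>. These span \<open>H\<close>, so it says
  that \<open>f - l \<phi>\<close> is orthogonal to \<open>H\<close> (\<open>multiplier_iff_orthogonal\<close>). The values for the bidegrees
  \<open>(m, n)\<close> with \<open>m + n = k\<close> all equal \<open>\<lambda>(k)\<close>, the value for degree \<open>k\<close>. Hence the two graphs
  correspond as soon as \<open>H\<^sub>k \<circ> \<Upsilon>\<close> is the linear span of the spaces \<open>H\<^sub>m\<^sub>,\<^sub>n\<close> with \<open>m + n = k\<close>.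

  One inclusion is immediate, because \<open>\<Upsilon>\<close> identifies the Laplacian of \<open>\<real>\<^sup>2\<^sup>d\<close> with the complex
  Laplacian, and \<open>z\<^sub>j\<close> and \<open>cnj z\<^sub>j\<close> with linear forms (\<open>complex_laplacian_Upsilon\<close>,
  \<open>bihomogeneous_comp_inv_Upsilon\<close>). For the other, a homogeneous polynomial of degree \<open>k\<close> in the real
  coordinates is a sum of bihomogeneous ones, as \<open>x\<^sub>j\<close> and \<open>y\<^sub>j\<close> are combinations of \<open>z\<^sub>j\<close> and its
  conjugate (\<open>homogeneous_comp_Upsilon\<close>). If the sum is harmonic, so is every summand: the
  Laplacian commutes with \<open>z \<mapsto> w z\<close> for \<open>w\<close> on the unit circle, this map multiplies the summand of
  bidegree \<open>(m, n)\<close> by \<open>w\<close> to the power \<open>m - n\<close>, and these powers are linearly independent functions of \<open>w\<close>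
  (\<open>harmonic_bihomogeneous_components\<close>).
\<close>

section \<open>Widths and isometric isomorphisms\<close>

text \<open>
  The map is a bijection of the whole types, not only of the carriers. Then \<open>V \<mapsto> \<Phi> ` V\<close> is a bijection
  between all sets on the two sides, and spans, which are intersections over all subspaces
  containing a set, are preserved even for sets that lie in no subspace.
\<close>

locale normed_sp_iso =
  fixes X :: "'v normed_sp" and Y :: "'w normed_sp" and \<Phi> :: "'v \<Rightarrow> 'w"
  assumes bij: "bij \<Phi>"
    and vecs: "vecs Y = \<Phi> ` vecs X"
    and zero: "vzero Y = \<Phi> (vzero X)"
    and add: "\<lbrakk>x \<in> vecs X; y \<in> vecs X\<rbrakk> \<Longrightarrow> vadd Y (\<Phi> x) (\<Phi> y) = \<Phi> (vadd X x y)"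
    and scale: "x \<in> vecs X \<Longrightarrow> vscale Y c (\<Phi> x) = \<Phi> (vscale X c x)"
    and norm: "x \<in> vecs X \<Longrightarrow> vnorm Y (\<Phi> x) = vnorm X x"
    and closed: "\<lbrakk>x \<in> vecs X; y \<in> vecs X\<rbrakk> \<Longrightarrow> vadd X x y \<in> vecs X"
begin

lemma eq_iff: "\<Phi> x = \<Phi> y \<longleftrightarrow> x = y"
  using bij by (simp add: bij_def inj_eq)

lemma mem_image: "\<Phi> x \<in> \<Phi> ` V \<longleftrightarrow> x \<in> V"
  using bij by (simp add: bij_def inj_image_mem_iff)

lemma image_subset: "\<Phi> ` V \<subseteq> \<Phi> ` W \<longleftrightarrow> V \<subseteq> W"
  using bij by (simp add: bij_def inj_image_subset_iff)

lemma all_sets: "(\<forall>W. P W) \<longleftrightarrow> (\<forall>V. P (\<Phi> ` V))"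
  using bij by (metis bij_def image_inv_f_f surj_f_inv_f image_f_inv_f)

text \<open>
  All widths are infima or suprema over families of subspaces. This turns a family on the
  side of \<open>Y\<close> into the image of the corresponding family on the side of \<open>X\<close>.
\<close>

lemma Collect_image:
  assumes "\<And>V. P (\<Phi> ` V) \<longleftrightarrow> Q V"
  shows "Collect P = (`) \<Phi> ` Collect Q"
proof -
  have "W \<in> (`) \<Phi> ` Collect Q" if "P W" for W
    using that assms bij by (metis bij_def image_f_inv_f image_eqI mem_Collect_eq)
  then show ?thesis
    using assms by auto
qed

lemma subspace_of: "subspace_of Y (\<Phi> ` V) \<longleftrightarrow> subspace_of X V"
proof (cases "V \<subseteq> vecs X")
  case True
  then show ?thesis
    by (auto simp: subspace_of_def vecs zero mem_image add scale subset_eq)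
next
  case False
  then show ?thesis
    by (simp add: subspace_of_def vecs image_subset)
qed

lemma span_in: "span_in Y (\<Phi> ` B) = \<Phi> ` span_in X B"
proof -
  have "{W. subspace_of Y W \<and> \<Phi> ` B \<subseteq> W} = (`) \<Phi> ` {V. subspace_of X V \<and> B \<subseteq> V}"
    by (rule Collect_image) (simp add: subspace_of image_subset)
  then show ?thesis
    using bij_image_INT[OF bij, of id "{V. subspace_of X V \<and> B \<subseteq> V}"]
    by (simp add: span_in_def hull_def)
qed

lemma independent_in: "independent_in Y (\<Phi> ` B) \<longleftrightarrow> independent_in X B"
proof -
  have "\<Phi> ` B - {\<Phi> b} = \<Phi> ` (B - {b})" for b
    by (auto simp: eq_iff)
  then show ?thesis
    by (simp add: independent_in_def span_in mem_image)
qed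

lemma subspace_dim: "subspace_dim Y n (\<Phi> ` V) \<longleftrightarrow> subspace_dim X n V"
proof -
  have inj: "inj_on \<Phi> B" for B
    using bij by (auto simp: bij_def inj_on_def)
  have *: "\<Phi> ` A = \<Phi> ` B \<longleftrightarrow> A = B" for A B
    using bij by (simp add: bij_def inj_image_eq_iff)
  show ?thesis
    by (simp add: subspace_dim_def subspace_of ex_subset_image_inj finite_image_iff card_image inj
        independent_in span_in image_subset * cong: conj_cong)
qed

lemma subspace_codim: "subspace_codim Y n (\<Phi> ` L) \<longleftrightarrow> subspace_codim X n L"
proof -
  have W: "(\<exists>W. P W) \<longleftrightarrow> (\<exists>V. P (\<Phi> ` V))" for P
    using all_sets[of "\<lambda>W. \<not> P W"] by blast
  have "(subspace_dim Y n (\<Phi> ` V) \<and> \<Phi> ` L \<inter> \<Phi> ` V = {vzero Y} \<and>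
        (\<forall>x\<in>vecs Y. \<exists>u\<in>\<Phi> ` L. \<exists>w\<in>\<Phi> ` V. x = vadd Y u w)) \<longleftrightarrow>
      (subspace_dim X n V \<and> L \<inter> V = {vzero X} \<and>
        (\<forall>x\<in>vecs X. \<exists>u\<in>L. \<exists>w\<in>V. x = vadd X u w))" if "subspace_of X L" for V
  proof (cases "subspace_dim X n V")
    case True
    then have sub: "L \<subseteq> vecs X" "V \<subseteq> vecs X"
      using that by (auto simp: subspace_dim_def subspace_of_def)
    have "\<Phi> ` L \<inter> \<Phi> ` V = {vzero Y} \<longleftrightarrow> L \<inter> V = {vzero X}"
    proof -
      have "\<Phi> ` L \<inter> \<Phi> ` V = \<Phi> ` (L \<inter> V)" "{vzero Y} = \<Phi> ` {vzero X}"
        using bij by (auto simp: bij_def image_Int zero)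
      then show ?thesis
        using bij by (simp only: bij_def inj_image_eq_iff)
    qed
    moreover have "(\<exists>u\<in>\<Phi> ` L. \<exists>w\<in>\<Phi> ` V. \<Phi> x = vadd Y u w) \<longleftrightarrow> (\<exists>u\<in>L. \<exists>w\<in>V. x = vadd X u w)" for x
    proof -
      have "\<Phi> x = vadd Y (\<Phi> u) (\<Phi> w) \<longleftrightarrow> x = vadd X u w" if "u \<in> L" "w \<in> V" for u w
        using that sub by (simp add: subsetD add eq_iff)
      then show ?thesis by (simp cong: bex_cong)
    qed
    ultimately show ?thesis
      by (simp add: subspace_dim vecs)
  qed (simp add: subspace_dim)
  then show ?thesis
    unfolding subspace_codim_def subspace_of by (subst W) (simp cong: conj_cong)
qed

lemma norm_vdiff:
  assumes "x \<in> vecs X" "y \<in> V" "subspace_of X V"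
  shows "vnorm Y (vdiff Y (\<Phi> x) (\<Phi> y)) = vnorm X (vdiff X x y)"
proof -
  have "y \<in> vecs X" "vscale X (-1) y \<in> vecs X"
    using assms(2,3) by (auto simp: subspace_of_def)
  with assms(1) show ?thesis
    by (simp add: vdiff_def scale add norm closed)
qed

lemma kolmogorov_width:
  assumes "A \<subseteq> vecs X"
  shows "kolmogorov_width n (\<Phi> ` A) Y = kolmogorov_width n A X"
proof -
  have "(SUP x\<in>A. INF y\<in>V. ennreal (vnorm Y (vdiff Y (\<Phi> x) (\<Phi> y)))) =
      (SUP x\<in>A. INF y\<in>V. ennreal (vnorm X (vdiff X x y)))" if "subspace_dim X n V" for V
    using that assms by (intro SUP_cong INF_cong refl) (auto simp: norm_vdiff subspace_dim_def)
  moreover have "{V. subspace_dim Y n V} = (`) \<Phi> ` {V. subspace_dim X n V}"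
    by (rule Collect_image) (rule subspace_dim)
  ultimately show ?thesis
    unfolding kolmogorov_width_def by (simp add: image_image)
qed

lemma gelfand_width:
  assumes "A \<subseteq> vecs X"
  shows "gelfand_width n (\<Phi> ` A) Y = gelfand_width n A X"
proof -
  have "(SUP x\<in>\<Phi> ` A \<inter> \<Phi> ` L. ennreal (vnorm Y x)) = (SUP x\<in>A \<inter> L. ennreal (vnorm X x))" for L
  proof -
    have "\<Phi> ` A \<inter> \<Phi> ` L = \<Phi> ` (A \<inter> L)"
      using bij by (simp add: bij_def image_Int)
    then show ?thesis
      using assms by (simp add: image_image) (intro SUP_cong refl, auto simp: norm)
  qed
  moreover have "{L. subspace_codim Y n L} = (`) \<Phi> ` {L. subspace_codim X n L}"
    by (rule Collect_image) (rule subspace_codim)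
  ultimately show ?thesis
    unfolding gelfand_width_def by (simp add: image_image)
qed

lemma bernstein_width:
  assumes "A \<subseteq> vecs X"
  shows "bernstein_width n (\<Phi> ` A) Y = bernstein_width n A X"
proof -
  have "unit_ball Y = \<Phi> ` unit_ball X"
    by (auto simp: unit_ball_def vecs norm)
  then have "vscale Y c ` unit_ball Y = \<Phi> ` vscale X c ` unit_ball X" for c
    by (simp add: image_image) (intro image_cong refl, auto simp: unit_ball_def scale)
  moreover have "\<Phi> ` U \<inter> \<Phi> ` V \<subseteq> \<Phi> ` A \<longleftrightarrow> U \<inter> V \<subseteq> A" for U V
    using bij by (simp add: bij_def image_Int[symmetric] image_subset)
  ultimately have "vscale Y c ` unit_ball Y \<inter> \<Phi> ` V \<subseteq> \<Phi> ` A \<longleftrightarrow>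
      vscale X c ` unit_ball X \<inter> V \<subseteq> A" for c V
    by simp
  moreover have "{V. subspace_dim Y (n + 1) V} = (`) \<Phi> ` {V. subspace_dim X (n + 1) V}"
    by (rule Collect_image) (rule subspace_dim)
  ultimately show ?thesis
    unfolding bernstein_width_def by (simp add: image_image)
qed

text \<open>
  Conjugation by \<open>\<Phi>\<close> matches the operators that compete in the linear width.
\<close>

lemma bounded_linear_op_conj:
  "bounded_linear_op Y (\<Phi> \<circ> P \<circ> inv \<Phi>) \<longleftrightarrow> bounded_linear_op X P"
proof -
  have inv: "inv \<Phi> (\<Phi> x) = x" for x
    using bij by (simp add: bij_def)
  show ?thesis
  proof (cases "\<forall>x\<in>vecs X. P x \<in> vecs X")
    case True
    then show ?thesis
      by (simp add: bounded_linear_op_def vecs inv mem_image add scale norm eq_iff)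
  next
    case False
    then show ?thesis
      by (auto simp: bounded_linear_op_def vecs inv mem_image)
  qed
qed

lemma linear_width:
  assumes "A \<subseteq> vecs X"
  shows "linear_width n (\<Phi> ` A) Y = linear_width n A X"
proof -
  let ?conj = "\<lambda>P. \<Phi> \<circ> P \<circ> inv \<Phi>"
  have inv: "inv \<Phi> (\<Phi> x) = x" "\<Phi> (inv \<Phi> y) = y" for x y
    using bij by (simp_all add: bij_def surj_f_inv_f)
  have range: "subspace_dim Y n (?conj P ` vecs Y) \<longleftrightarrow> subspace_dim X n (P ` vecs X)" for P
    using subspace_dim[of n "P ` vecs X"] by (simp add: vecs image_image inv)
  have "{Q. bounded_linear_op Y Q \<and> subspace_dim Y n (Q ` vecs Y)} =
      ?conj ` {P. bounded_linear_op X P \<and> subspace_dim X n (P ` vecs X)}" (is "?L = _ ` ?R")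
  proof (intro equalityI subsetI)
    fix Q assume Q: "Q \<in> ?L"
    have "Q = ?conj (inv \<Phi> \<circ> Q \<circ> \<Phi>)"
      by (simp add: fun_eq_iff inv)
    with Q show "Q \<in> ?conj ` ?R"
      by (intro image_eqI[of _ _ "inv \<Phi> \<circ> Q \<circ> \<Phi>"])
        (simp_all only: mem_Collect_eq flip: bounded_linear_op_conj range)
  qed (auto simp only: mem_Collect_eq bounded_linear_op_conj range)
  moreover have "(SUP x\<in>A. ennreal (vnorm Y (vdiff Y (\<Phi> x) (\<Phi> (P x))))) =
      (SUP x\<in>A. ennreal (vnorm X (vdiff X x (P x))))" if "subspace_dim X n (P ` vecs X)" for P
    using that assms
    by (intro SUP_cong refl) (subst norm_vdiff[of _ _ "P ` vecs X"], auto simp: subspace_dim_def)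
  ultimately show ?thesis
    unfolding linear_width_def by (simp add: image_image inv)
qed

end

section \<open>\<open>L\<^sup>p\<close> spaces on isomorphic measure spaces\<close>

text \<open>
  Again \<open>u\<close> is a bijection of the whole types: elements of \<open>L\<^sup>p\<close> are classes of functions that are total on
  the type, so that composition with \<open>u\<close> has to be invertible off the space of the measure too.
\<close>

locale measure_iso =
  fixes M :: "'a measure" and N :: "'b measure" and u :: "'a \<Rightarrow> 'b"
  assumes bij: "bij u"
    and space_image: "u ` space M = space N"
    and measurable_u [measurable]: "u \<in> measurable M N"
    and sets_image: "E \<in> sets M \<Longrightarrow> u ` E \<in> sets N"
    and emeasure_image: "E \<in> sets M \<Longrightarrow> emeasure N (u ` E) = emeasure M E"
begin

lemma image_vimage:
  assumes "E \<subseteq> space N"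
  shows "u ` (u -` E \<inter> space M) = E"
  using assms unfolding space_image[symmetric] by auto

lemma distr_eq: "distr M N u = N"
proof (rule measure_eqI)
  fix E assume "E \<in> sets (distr M N u)"
  then have E: "E \<in> sets N" by simp
  then have "emeasure (distr M N u) E = emeasure M (u -` E \<inter> space M)"
    by (simp add: emeasure_distr)
  also have "\<dots> = emeasure N E"
    using E sets.sets_into_space[OF E] by (subst emeasure_image[symmetric]) (auto simp: image_vimage)
  finally show "emeasure (distr M N u) E = emeasure N E" .
qed simp

lemma AE_iff: "(AE y in N. P y) \<longleftrightarrow> (AE x in M. P (u x))"
proof
  assume "AE y in N. P y"
  then have "AE y in distr M N u. P y" unfolding distr_eq .
  then show "AE x in M. P (u x)"
    by (rule AE_distrD[rotated]) measurable
next
  assume "AE x in M. P (u x)"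
  then obtain E where E: "E \<in> null_sets M" "{x \<in> space M. \<not> P (u x)} \<subseteq> E"
    by (auto simp: eventually_ae_filter)
  then have "u ` E \<in> null_sets N"
    by (auto simp: null_sets_def sets_image emeasure_image)
  moreover have "{y \<in> space N. \<not> P y} \<subseteq> u ` E"
    using E(2) by (auto simp flip: space_image)
  ultimately show "AE y in N. P y"
    by (auto simp: eventually_ae_filter)
qed

lemma borel_measurable_iff:
  fixes f :: "'b \<Rightarrow> 'c::topological_space"
  shows "f \<in> borel_measurable N \<longleftrightarrow> f \<circ> u \<in> borel_measurable M"
proof
  assume m: "f \<circ> u \<in> borel_measurable M"
  show "f \<in> borel_measurable N"
  proof (rule measurableI)
    fix A :: "'c set" assume "A \<in> sets borel"
    then have "u ` ((f \<circ> u) -` A \<inter> space M) \<in> sets N"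
      using m by (intro sets_image) (rule measurable_sets)
    also have "u ` ((f \<circ> u) -` A \<inter> space M) = f -` A \<inter> space N"
      by (auto simp flip: space_image)
    finally show "f -` A \<inter> space N \<in> sets N" .
  qed simp
qed (auto intro: measurable_comp[OF measurable_u])

lemma integrable_iff:
  fixes f :: "'b \<Rightarrow> 'c::{banach, second_countable_topology}"
  shows "f \<in> borel_measurable N \<Longrightarrow> integrable N f \<longleftrightarrow> integrable M (f \<circ> u)"
  using integrable_distr_eq[OF measurable_u, of f] by (simp add: distr_eq comp_def)

lemma integral_eq:
  fixes f :: "'b \<Rightarrow> 'c::{banach, second_countable_topology}"
  shows "f \<in> borel_measurable N \<Longrightarrow> integral\<^sup>L N f = (LINT x|M. f (u x))"
  using integral_distr[OF measurable_u, of f] by (simp add: distr_eq)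

lemma esssup_eq:
  fixes f :: "'b \<Rightarrow> ennreal"
  assumes "f \<in> borel_measurable N"
  shows "esssup N f = esssup M (f \<circ> u)"
  using assms borel_measurable_iff[of f] by (simp add: esssup_eq_AE AE_iff)

lemma Lp_fun_iff: "f \<in> Lp_fun N p \<longleftrightarrow> f \<circ> u \<in> Lp_fun M p"
proof (cases "f \<in> borel_measurable N")
  case True
  then have [measurable]: "f \<in> borel_measurable N" .
  have "(\<lambda>x. ennreal (cmod (f x))) \<in> borel_measurable N"
    "(\<lambda>x. cmod (f x) powr enn2real p) \<in> borel_measurable N" by measurable
  with True show ?thesis
    by (simp add: Lp_fun_def esssup_eq integrable_iff borel_measurable_iff comp_def)
next
  case False
  then show ?thesis
    by (simp add: Lp_fun_def borel_measurable_iff)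
qed

lemma Lp_norm_eq:
  assumes [measurable]: "f \<in> borel_measurable N"
  shows "Lp_norm N p f = Lp_norm M p (f \<circ> u)"
proof -
  have "(\<lambda>x. ennreal (cmod (f x))) \<in> borel_measurable N"
    "(\<lambda>x. cmod (f x) powr enn2real p) \<in> borel_measurable N" by measurable
  then show ?thesis
    by (simp add: Lp_norm_def esssup_eq integral_eq comp_def)
qed

end

lemma Lp_fun_cong_AE:
  assumes "f \<in> Lp_fun M p" "g \<in> borel_measurable M" "AE x in M. f x = g x"
  shows "g \<in> Lp_fun M p"
proof -
  have [measurable]: "f \<in> borel_measurable M" "g \<in> borel_measurable M"
    using assms by (auto simp: Lp_fun_def)
  have "esssup M (\<lambda>x. ennreal (cmod (f x))) = esssup M (\<lambda>x. ennreal (cmod (g x)))"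
    using assms(3) by (intro esssup_AE_cong) auto
  moreover have "integrable M (\<lambda>x. cmod (f x) powr enn2real p) \<longleftrightarrow>
      integrable M (\<lambda>x. cmod (g x) powr enn2real p)"
    using assms(3) by (intro integrable_cong_AE) auto
  ultimately show ?thesis
    using assms by (auto simp: Lp_fun_def)
qed

lemma Lp_norm_cong_AE:
  assumes [measurable]: "f \<in> borel_measurable M" "g \<in> borel_measurable M"
    and ae: "AE x in M. f x = g x"
  shows "Lp_norm M p f = Lp_norm M p g"
proof -
  have "esssup M (\<lambda>x. ennreal (cmod (f x))) = esssup M (\<lambda>x. ennreal (cmod (g x)))"
    using ae by (intro esssup_AE_cong) auto
  moreover have "(LINT x|M. cmod (f x) powr enn2real p) = (LINT x|M. cmod (g x) powr enn2real p)"
    using ae by (intro integral_cong_AE) auto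
  ultimately show ?thesis
    by (simp add: Lp_norm_def)
qed

lemma ae_class_cong:
  assumes "f \<in> borel_measurable M" "g \<in> borel_measurable M" "AE x in M. f x = g x"
  shows "ae_class M p f = ae_class M p g"
proof -
  have "ae_class M p g \<subseteq> ae_class M p f"
    if "f \<in> borel_measurable M" "g \<in> borel_measurable M" "AE x in M. f x = g x" for f g
  proof
    fix h assume "h \<in> ae_class M p g"
    then have h: "g \<in> Lp_fun M p" "h \<in> Lp_fun M p" "AE x in M. g x = h x"
      by (auto simp: ae_class_def ae_eq_def)
    then have "f \<in> Lp_fun M p" "AE x in M. f x = h x"
      using that by (auto intro: Lp_fun_cong_AE)
    with h show "h \<in> ae_class M p f"
      by (auto simp: ae_class_def ae_eq_def)
  qed
  from this[OF assms] this[OF assms(2,1)] assms(3) show ?thesis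
    by (auto simp: eq_commute)
qed

lemma vecs_Lp: "vecs (Lp M p) = ae_class M p ` Lp_fun M p"
  by (auto simp: Lp_def ae_class_def quotient_def)

lemma rep_ae_class:
  assumes "f \<in> Lp_fun M p"
  shows "rep (ae_class M p f) \<in> Lp_fun M p" "AE x in M. rep (ae_class M p f) x = f x"
proof -
  have "f \<in> ae_class M p f"
    using assms by (simp add: ae_class_def ae_eq_def)
  then have "rep (ae_class M p f) \<in> ae_class M p f"
    unfolding rep_def by (rule someI[where P = "\<lambda>g. g \<in> ae_class M p f"])
  then show "rep (ae_class M p f) \<in> Lp_fun M p" "AE x in M. rep (ae_class M p f) x = f x"
    by (auto simp: ae_class_def ae_eq_def)
qed

lemma rep_Lp_fun: "F \<in> vecs (Lp M p) \<Longrightarrow> rep F \<in> Lp_fun M p"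
  by (auto simp: vecs_Lp rep_ae_class)

lemma Lp_fun_measurable: "f \<in> Lp_fun M p \<Longrightarrow> f \<in> borel_measurable M"
  by (simp add: Lp_fun_def)

lemma ae_class_rep:
  assumes "F \<in> vecs (Lp M p)"
  shows "ae_class M p (rep F) = F"
proof -
  obtain f where f: "f \<in> Lp_fun M p" "F = ae_class M p f"
    using assms by (auto simp: vecs_Lp)
  have "ae_class M p (rep (ae_class M p f)) = ae_class M p f"
    using rep_ae_class[OF f(1)] f(1) by (intro ae_class_cong) (auto simp: Lp_fun_measurable)
  with f(2) show ?thesis by simp
qed

text \<open>
  From \<open>\<bar>a + b\<bar> \<le> 2 max \<bar>a\<bar> \<bar>b\<bar>\<close>, or the triangle inequality for the essential supremum.
\<close>

lemma Lp_fun_add: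
  assumes p: "1 \<le> p" and f: "f \<in> Lp_fun M p" and g: "g \<in> Lp_fun M p"
  shows "(\<lambda>x. f x + g x) \<in> Lp_fun M p"
proof -
  have [measurable]: "f \<in> borel_measurable M" "g \<in> borel_measurable M"
    using assms by (auto simp: Lp_fun_def)
  show ?thesis
  proof (cases "p = \<infinity>")
    case True
    have "AE x in M. ennreal (cmod (f x)) \<le> esssup M (\<lambda>x. ennreal (cmod (f x)))"
      "AE x in M. ennreal (cmod (g x)) \<le> esssup M (\<lambda>x. ennreal (cmod (g x)))"
      by (rule esssup_AE)+
    then have "AE x in M. ennreal (cmod (f x + g x)) \<le>
        esssup M (\<lambda>x. ennreal (cmod (f x))) + esssup M (\<lambda>x. ennreal (cmod (g x)))"
    proof eventually_elim
      case (elim x)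
      have "ennreal (cmod (f x + g x)) \<le> ennreal (cmod (f x)) + ennreal (cmod (g x))"
        by (simp add: norm_triangle_ineq flip: ennreal_plus)
      also have "\<dots> \<le> esssup M (\<lambda>x. ennreal (cmod (f x))) + esssup M (\<lambda>x. ennreal (cmod (g x)))"
        using elim by (rule add_mono)
      finally show ?case .
    qed
    then have "esssup M (\<lambda>x. ennreal (cmod (f x + g x))) \<le>
        esssup M (\<lambda>x. ennreal (cmod (f x))) + esssup M (\<lambda>x. ennreal (cmod (g x)))"
      by (intro esssup_I) auto
    also have "\<dots> < \<infinity>"
      using f g True by (auto simp: Lp_fun_def)
    finally show ?thesis
      using True by (simp add: Lp_fun_def)
  next
    case False
    define r where "r = enn2real p"
    have "0 \<le> r" by (simp add: r_def)
    have "cmod (f x + g x) powr r \<le> 2 powr r * (cmod (f x) powr r + cmod (g x) powr r)" for x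
    proof -
      have "cmod (f x + g x) powr r \<le> (2 * max (cmod (f x)) (cmod (g x))) powr r"
        using \<open>0 \<le> r\<close> norm_triangle_ineq[of "f x" "g x"] by (intro powr_mono2) auto
      also have "\<dots> = 2 powr r * max (cmod (f x)) (cmod (g x)) powr r"
        by (simp add: powr_mult)
      also have "\<dots> \<le> 2 powr r * (cmod (f x) powr r + cmod (g x) powr r)"
        by (intro mult_left_mono) (auto simp: max_def)
      finally show ?thesis .
    qed
    moreover have "integrable M (\<lambda>x. 2 powr r * (cmod (f x) powr r + cmod (g x) powr r))"
      using f g False by (auto simp: Lp_fun_def r_def)
    ultimately have "integrable M (\<lambda>x. cmod (f x + g x) powr r)"
      by (elim Bochner_Integration.integrable_bound) auto
    with False show ?thesis
      by (simp add: Lp_fun_def r_def)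
  qed
qed

text \<open>
  On a finite measure space \<open>\<bar>f\<bar> \<le> 1 + \<bar>f\<bar>\<^sup>p\<close> is integrable; for \<open>p = \<infinity>\<close> the function is essentially
  bounded.
\<close>

lemma (in finite_measure) Lp_fun_integrable:
  assumes p: "1 \<le> p" and f: "f \<in> Lp_fun M p"
  shows "integrable M f"
proof (cases "p = \<infinity>")
  case True
  have [measurable]: "f \<in> borel_measurable M"
    using f by (rule Lp_fun_measurable)
  let ?s = "esssup M (\<lambda>x. ennreal (cmod (f x)))"
  have fin: "?s < \<infinity>"
    using f True by (simp add: Lp_fun_def)
  have "AE x in M. ennreal (cmod (f x)) \<le> ?s"
    by (rule esssup_AE)
  then have "AE x in M. cmod (f x) \<le> enn2real ?s"
    by eventually_elim (metis fin ennreal_enn2real enn2real_nonneg ennreal_le_iff infinity_ennreal_def)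
  then show ?thesis
    by (intro integrable_const_bound) auto
next
  case False
  then obtain r where r: "p = ennreal r" "1 \<le> r"
    using p by (cases p) auto
  have [measurable]: "f \<in> borel_measurable M"
    using f by (rule Lp_fun_measurable)
  have "norm (f x) \<le> norm (1 + cmod (f x) powr r)" for x
  proof (cases "cmod (f x) \<le> 1")
    case False
    then have "cmod (f x) powr 1 \<le> cmod (f x) powr r"
      using r by (intro powr_mono) auto
    with False show ?thesis by auto
  qed (simp add: add_increasing2)
  moreover have "integrable M (\<lambda>x. 1 + cmod (f x) powr r)"
    using f False r by (simp add: Lp_fun_def)
  ultimately show ?thesis
    by (elim Bochner_Integration.integrable_bound) auto
qed

context measure_iso
begin

definition pull :: "('b \<Rightarrow> complex) set \<Rightarrow> ('a \<Rightarrow> complex) set" where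
  "pull F = (\<lambda>f. f \<circ> u) ` F"

lemma bij_comp: "bij (\<lambda>f :: 'b \<Rightarrow> complex. f \<circ> u)"
proof (rule o_bij[where g = "\<lambda>f. f \<circ> inv u"])
  show "(\<lambda>f. f \<circ> inv u) \<circ> (\<lambda>f. f \<circ> u) = id" "(\<lambda>f. f \<circ> u) \<circ> (\<lambda>f. f \<circ> inv u) = id"
    using bij by (auto simp: fun_eq_iff bij_def surj_f_inv_f)
qed

lemma bij_pull: "bij pull"
proof -
  have "pull = image (\<lambda>f. f \<circ> u)"
    by (simp add: fun_eq_iff pull_def)
  then show ?thesis
    using bij_betw_Pow[OF bij_comp] by simp
qed

lemma comp_image_eqI:
  fixes B :: "('a \<Rightarrow> complex) set"
  assumes "\<And>f. f \<in> A \<longleftrightarrow> f \<circ> u \<in> B"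
  shows "(\<lambda>f. f \<circ> u) ` A = B"
proof (intro equalityI subsetI)
  fix h assume "h \<in> B"
  moreover obtain f where "h = f \<circ> u"
    using surjD[OF bij_is_surj[OF bij_comp]] by blast
  ultimately show "h \<in> (\<lambda>f. f \<circ> u) ` A"
    using assms by auto
qed (use assms in auto)

lemma pull_ae_class: "pull (ae_class N p f) = ae_class M p (f \<circ> u)"
  unfolding pull_def
  by (rule comp_image_eqI) (auto simp: ae_class_def ae_eq_def Lp_fun_iff AE_iff)

lemma vecs_pull: "vecs (Lp M p) = pull ` vecs (Lp N p)"
proof -
  have "Lp_fun M p = (\<lambda>f. f \<circ> u) ` Lp_fun N p"
    by (rule comp_image_eqI[symmetric]) (rule Lp_fun_iff)
  then show ?thesis
    by (simp add: vecs_Lp image_image pull_ae_class)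
qed

lemma rep_pull:
  assumes "F \<in> vecs (Lp N p)"
  shows "rep (pull F) \<in> Lp_fun M p" "AE x in M. rep (pull F) x = rep F (u x)"
proof -
  have "pull F = ae_class M p (rep F \<circ> u)"
    using ae_class_rep[OF assms] pull_ae_class by metis
  moreover have "rep F \<circ> u \<in> Lp_fun M p"
    using rep_Lp_fun[OF assms] by (simp add: Lp_fun_iff)
  ultimately show "rep (pull F) \<in> Lp_fun M p" "AE x in M. rep (pull F) x = rep F (u x)"
    using rep_ae_class[of "rep F \<circ> u" M p] by auto
qed

text \<open>
  The operations on classes are defined through chosen representatives. The one chosen for
  \<open>pull F\<close> agrees with \<open>rep F \<circ> u\<close> only almost everywhere, but sums, multiples
  and norms respect this.
\<close>

lemma normed_sp_iso_pull:
  assumes "1 \<le> p"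
  shows "normed_sp_iso (Lp N p) (Lp M p) pull"
proof
  have m: "rep F \<in> borel_measurable N" "rep F \<circ> u \<in> borel_measurable M"
    "rep (pull F) \<in> borel_measurable M"
    if "F \<in> vecs (Lp N p)" for F
    using that rep_Lp_fun rep_pull(1) Lp_fun_measurable borel_measurable_iff by blast+
  show "bij pull" by (rule bij_pull)
  show "vecs (Lp M p) = pull ` vecs (Lp N p)" by (rule vecs_pull)
  show "vzero (Lp M p) = pull (vzero (Lp N p))"
    by (simp add: Lp_def pull_ae_class comp_def)
  fix F G assume F: "F \<in> vecs (Lp N p)"
  { fix c
    have "ae_class M p (\<lambda>x. c * rep (pull F) x) = ae_class M p ((\<lambda>x. c * rep F x) \<circ> u)"
      using rep_pull(2)[OF F] m[OF F] by (intro ae_class_cong) (auto simp: comp_def)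
    then show "vscale (Lp M p) c (pull F) = pull (vscale (Lp N p) c F)"
      by (simp add: Lp_def pull_ae_class) }
  show "vnorm (Lp M p) (pull F) = vnorm (Lp N p) F"
    using Lp_norm_cong_AE[of "rep (pull F)" M "rep F \<circ> u" p] rep_pull(2)[OF F] m[OF F]
    by (simp add: Lp_def Lp_norm_eq)
  assume G: "G \<in> vecs (Lp N p)"
  have "AE x in M. rep (pull F) x + rep (pull G) x = rep F (u x) + rep G (u x)"
    using rep_pull(2)[OF F] rep_pull(2)[OF G] by eventually_elim simp
  then have "ae_class M p (\<lambda>x. rep (pull F) x + rep (pull G) x) =
      ae_class M p ((\<lambda>x. rep F x + rep G x) \<circ> u)"
    using m[OF F] m[OF G] by (intro ae_class_cong) (auto simp: comp_def)
  then show "vadd (Lp M p) (pull F) (pull G) = pull (vadd (Lp N p) F G)"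
    by (simp add: Lp_def pull_ae_class)
  have "vadd (Lp N p) F G = ae_class N p (\<lambda>x. rep F x + rep G x)"
    by (simp add: Lp_def)
  moreover have "(\<lambda>x. rep F x + rep G x) \<in> Lp_fun N p"
    using assms F G by (intro Lp_fun_add rep_Lp_fun)
  ultimately show "vadd (Lp N p) F G \<in> vecs (Lp N p)"
    unfolding vecs_Lp by (rule image_eqI)
qed

end

section \<open>The surface measures\<close>

lemma measure_iso_Upsilon:
  "measure_iso (sigma_Omega :: (complex ^ 'd) measure) surface_measure Upsilon"
proof
  have surj: "surj (Upsilon :: complex ^ 'd \<Rightarrow> _)"
    using Upsilon_image_eq_vimage[of "UNIV :: (complex ^ 'd) set"] by simp
  then show "bij (Upsilon :: complex ^ 'd \<Rightarrow> _)"
    by (simp add: bij_def inj_Upsilon)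
  show "Upsilon ` space (sigma_Omega :: (complex ^ 'd) measure) = space surface_measure"
    by (simp add: Upsilon_image_Omega)
  have "continuous_on UNIV (Upsilon :: complex ^ 'd \<Rightarrow> _)"
    unfolding Upsilon_def
  proof (rule continuous_on_vec_lambda)
    fix ki :: "'d \<times> 2"
    show "continuous_on UNIV (\<lambda>z :: complex ^ 'd. if snd ki = 1 then Re (z $ fst ki) else Im (z $ fst ki))"
      by (cases "snd ki = 1") (auto intro!: continuous_intros)
  qed
  then have "Upsilon \<in> measurable borel (borel :: (real ^ ('d \<times> 2)) measure)"
    by (rule borel_measurable_continuous_onI)
  then have "Upsilon \<in> measurable (restrict_space borel (Omega :: (complex ^ 'd) set)) (restrict_space borel (sphere 0 1))"
  proof (rule measurable_restrict_space3)
    show "Upsilon \<in> (Omega :: (complex ^ 'd) set) \<rightarrow> sphere 0 1"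
      unfolding Upsilon_image_Omega[symmetric] by auto
  qed
  then show "Upsilon \<in> measurable (sigma_Omega :: (complex ^ 'd) measure) surface_measure"
    by (simp add: measurable_cong_sets[OF sets_sigma_Omega sets_surface_measure])
  fix E :: "(complex ^ 'd) set" assume "E \<in> sets sigma_Omega"
  then have E: "E \<in> sets (restrict_space borel Omega)"
    by (simp add: sets_sigma_Omega)
  show "Upsilon ` E \<in> sets surface_measure"
    using E by (rule sets_Upsilon_image)
  show "emeasure surface_measure (Upsilon ` E) = emeasure sigma_Omega E"
    using E by (simp add: emeasure_sigma_Omega)
qed

lemma finite_measure_surface:
  "finite_measure (surface_measure :: 'e::euclidean_space measure)"
proof
  have "sphere 0 1 \<in> sets (restrict_space borel (sphere 0 1 :: 'e set))"
    by (simp add: sets_restrict_space_iff)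
  moreover have "emeasure lborel (cone_over (sphere 0 1) :: 'e set) \<le> emeasure lborel (cball 0 1 :: 'e set)"
    by (intro emeasure_mono) (auto simp: cone_over_eq_vimage)
  moreover have "\<dots> < \<infinity>"
    by (rule emeasure_bounded_finite) simp
  ultimately show "emeasure surface_measure (space (surface_measure :: 'e measure)) \<noteq> \<infinity>"
    by (auto simp: emeasure_surface_measure ennreal_mult_eq_top_iff)
qed

text \<open>
  The cone over a nonempty relatively open part of the sphere contains a ball.
\<close>

lemma null_set_surface_relatively_open:
  fixes V :: "'e::euclidean_space set"
  assumes V: "open V" and x: "x \<in> V" "norm x = 1"
    and null: "sphere 0 1 \<inter> V \<in> null_sets surface_measure"
  shows False
proof -
  define U where "U = (ball 0 1 - {0}) \<inter> (\<lambda>y. y /\<^sub>R norm y) -` V"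
  have "open U"
    unfolding U_def by (intro continuous_open_preimage V continuous_intros open_delete) auto
  moreover have "(1/2) *\<^sub>R x \<in> U"
    using x by (auto simp: U_def)
  ultimately obtain r where r: "0 < r" "ball ((1/2) *\<^sub>R x) r \<subseteq> U"
    by (meson open_contains_ball)
  have "0 < emeasure lborel (ball ((1/2) *\<^sub>R x) r)"
    using content_ball_pos[OF r(1), of "(1/2) *\<^sub>R x"] by (auto simp: measure_def enn2real_positive_iff)
  also have "\<dots> \<le> emeasure lborel U"
    using r(2) \<open>open U\<close> by (intro emeasure_mono) auto
  also have "emeasure lborel U \<le> emeasure lborel (cone_over (sphere 0 1 \<inter> V))"
  proof (rule emeasure_mono)
    show "U \<subseteq> cone_over (sphere 0 1 \<inter> V)"
      by (subst cone_over_eq_vimage) (auto simp: U_def)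
    show "cone_over (sphere 0 1 \<inter> V) \<in> sets lborel"
      using V by (auto intro!: sets_cone_over simp: sets_restrict_space_iff)
  qed
  finally have "0 < emeasure surface_measure (sphere 0 1 \<inter> V)"
    using V by (subst emeasure_surface_measure)
      (auto simp: sets_restrict_space_iff ennreal_zero_less_mult_iff)
  with null show False
    by (auto simp: null_sets_def)
qed

section \<open>Reproducing kernels of finite-dimensional function spaces\<close>

definition lin_closed :: "('a \<Rightarrow> complex) set \<Rightarrow> bool" where
  "lin_closed P \<longleftrightarrow> (\<lambda>_. 0) \<in> P \<and> (\<forall>f\<in>P. \<forall>g\<in>P. (\<lambda>x. f x + g x) \<in> P) \<and> (\<forall>c. \<forall>f\<in>P. (\<lambda>x. c * f x) \<in> P)"

lemma lin_closed_zero: "lin_closed P \<Longrightarrow> (\<lambda>_. 0) \<in> P"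
  and lin_closed_add: "\<lbrakk>lin_closed P; f \<in> P; g \<in> P\<rbrakk> \<Longrightarrow> (\<lambda>x. f x + g x) \<in> P"
  and lin_closed_scale: "\<lbrakk>lin_closed P; f \<in> P\<rbrakk> \<Longrightarrow> (\<lambda>x. c * f x) \<in> P"
  by (simp_all add: lin_closed_def)

lemma lin_closed_diff: "\<lbrakk>lin_closed P; f \<in> P; g \<in> P\<rbrakk> \<Longrightarrow> (\<lambda>x. f x - g x) \<in> P"
  using lin_closed_add[of P f "\<lambda>x. (-1) * g x"] lin_closed_scale[of P g "-1"] by simp

lemma lin_closed_sum:
  assumes "lin_closed P" "\<And>i. i \<in> I \<Longrightarrow> f i \<in> P"
  shows "(\<lambda>x. \<Sum>i\<in>I. f i x) \<in> P"
  using assms by (induction I rule: infinite_finite_induct) (auto simp: lin_closed_zero intro: lin_closed_add)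

text \<open>
  A space of bounded functions on which the inner product of \<open>L\<^sup>2(M)\<close> is definite with respect to the values on
  \<open>space M\<close>. The functions are total, and values off \<open>space M\<close> do not count; harmonics in the
  sense of \<open>sphere_harmonics\<close> and \<open>Omega_harmonics\<close> arise by restricting them to \<open>space M\<close>.
\<close>

locale kernel_space = finite_measure M for M :: "'a measure" +
  fixes P :: "('a \<Rightarrow> complex) set"
  assumes lin: "lin_closed P"
    and meas: "f \<in> P \<Longrightarrow> f \<in> borel_measurable M"
    and bdd: "f \<in> P \<Longrightarrow> \<exists>C. \<forall>x\<in>space M. cmod (f x) \<le> C"
    and definite: "\<lbrakk>f \<in> P; AE x in M. f x = 0; x \<in> space M\<rbrakk> \<Longrightarrow> f x = 0"
begin

lemma integrable_mult:
  assumes "integrable M g" "f \<in> P"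
  shows "integrable M (\<lambda>x. g x * f x)"
proof -
  obtain C where C: "\<And>x. x \<in> space M \<Longrightarrow> cmod (f x) \<le> C"
    using bdd[OF assms(2)] by auto
  have [measurable]: "f \<in> borel_measurable M" "g \<in> borel_measurable M"
    using meas[OF assms(2)] assms(1) by auto
  have "integrable M (\<lambda>x. C * cmod (g x))"
    using assms(1) by auto
  moreover have "AE x in M. norm (g x * f x) \<le> norm (C * cmod (g x))"
  proof (rule AE_I2)
    fix x assume "x \<in> space M"
    then have "0 \<le> C" "cmod (f x) \<le> C" using C norm_ge_zero order_trans by blast+
    then show "norm (g x * f x) \<le> norm (C * cmod (g x))"
      by (simp add: norm_mult mult.commute[of "cmod (g x)"] mult_right_mono)
  qed
  ultimately show ?thesis
    by (elim Bochner_Integration.integrable_bound) auto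
qed

lemma integrable_mult_cnj:
  assumes "integrable M g" "f \<in> P"
  shows "integrable M (\<lambda>x. g x * cnj (f x))"
proof -
  have "integrable M (\<lambda>x. cnj (g x))" using assms(1) by simp
  from integrable_mult[OF this assms(2)] have "integrable M (\<lambda>x. cnj (cnj (g x) * f x))"
    by (rule integrable_cnj)
  then show ?thesis by simp
qed

lemma integrable_P:
  assumes "f \<in> P" shows "integrable M f"
  using integrable_mult[of "\<lambda>_. 1", OF _ assms] by simp

lemmas integrable_inner = integrable_mult_cnj[OF integrable_P]

lemma eq_0_if_norm_0:
  assumes "f \<in> P" "(LINT x|M. f x * cnj (f x)) = 0" "x \<in> space M"
  shows "f x = 0"
proof -
  have "(LINT x|M. f x * cnj (f x)) = of_real (LINT x|M. (cmod (f x))\<^sup>2)"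
    by (simp only: complex_norm_square[symmetric] integral_complex_of_real)
  with assms have 0: "(LINT x|M. (cmod (f x))\<^sup>2) = 0" by simp
  have "integrable M (\<lambda>x. norm (f x * cnj (f x)))"
    using integrable_inner[OF assms(1,1)] by (rule integrable_norm)
  then have "integrable M (\<lambda>x. (cmod (f x))\<^sup>2)"
    by (simp add: norm_mult power2_eq_square)
  with 0 have "AE x in M. f x = 0"
    by (subst (asm) integral_nonneg_eq_0_iff_AE) auto
  with definite[OF assms(1) _ assms(3)] show ?thesis by blast
qed

lemma norm_pos:
  assumes "f \<in> P" "x \<in> space M" "f x \<noteq> 0"
  obtains r where "0 < r" "(LINT x|M. f x * cnj (f x)) = of_real r"
proof -
  have "(LINT x|M. f x * cnj (f x)) = of_real (LINT x|M. (cmod (f x))\<^sup>2)"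
    by (simp only: complex_norm_square[symmetric] integral_complex_of_real)
  moreover have "(LINT x|M. (cmod (f x))\<^sup>2) \<ge> 0" by simp
  ultimately show ?thesis
    using that eq_0_if_norm_0[OF assms(1) _ assms(2)] assms(3) by (metis less_eq_real_def of_real_0)
qed

end

definition (in kernel_space) orthonormal :: "nat \<Rightarrow> (nat \<Rightarrow> 'a \<Rightarrow> complex) \<Rightarrow> bool" where
  "orthonormal N e \<longleftrightarrow> (\<forall>i<N. e i \<in> P) \<and>
     (\<forall>i<N. \<forall>j<N. (LINT x|M. e i x * cnj (e j x)) = (if i = j then 1 else 0))"

lemma (in kernel_space) orthonormal_coeff:
  assumes e: "orthonormal N e" and f: "\<And>x. x \<in> space M \<Longrightarrow> f x = (\<Sum>i<N. a i * e i x)" and j: "j < N"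
  shows "(LINT x|M. f x * cnj (e j x)) = a j"
proof -
  have "(LINT x|M. f x * cnj (e j x)) = (LINT x|M. (\<Sum>i<N. a i * (e i x * cnj (e j x))))"
    by (intro Bochner_Integration.integral_cong refl) (simp add: f sum_distrib_right mult.assoc)
  also have "\<dots> = (\<Sum>i<N. a i * (LINT x|M. e i x * cnj (e j x)))"
    using e j by (subst Bochner_Integration.integral_sum) (auto intro!: integrable_inner simp: orthonormal_def)
  also have "\<dots> = (\<Sum>i<N. if i = j then a i else 0)"
    using e j by (intro sum.cong) (auto simp: orthonormal_def)
  finally show ?thesis using j by simp
qed

text \<open>
  Induction on the number of spanning functions. The subspace \<open>Q0\<close> of those members of \<open>Q\<close> that avoid the last
  spanning function has an orthonormal basis, and it has codimension at most one in \<open>Q\<close>; if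
  its basis does not suffice for \<open>Q\<close>, one Gram-Schmidt step completes it.
\<close>

lemma (in kernel_space) ex_orthonormal_basis:
  fixes b :: "nat \<Rightarrow> 'a \<Rightarrow> complex"
  assumes "lin_closed Q" "Q \<subseteq> P" "\<And>f. f \<in> Q \<Longrightarrow> \<exists>c. f = (\<lambda>x. \<Sum>i<n. c i * b i x)"
  shows "\<exists>N e. orthonormal N e \<and> (\<forall>i<N. e i \<in> Q) \<and>
     (\<forall>f\<in>Q. \<exists>a. \<forall>x\<in>space M. f x = (\<Sum>i<N. a i * e i x))"
  using assms
proof (induction n arbitrary: Q)
  case 0
  then have "f x = 0" if "f \<in> Q" for f x using that by fastforce
  then show ?case by (intro exI[of _ 0]) (auto simp: orthonormal_def)
next
  case (Suc n)
  define Q0 where "Q0 = {f \<in> Q. \<exists>c. f = (\<lambda>x. \<Sum>i<n. c i * b i x)}"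
  have "lin_closed Q0"
    unfolding lin_closed_def
  proof (intro conjI ballI allI)
    show "(\<lambda>_. 0) \<in> Q0"
      unfolding Q0_def using Suc.prems(1) by (auto intro!: exI[of _ "\<lambda>_. 0"] simp: lin_closed_zero)
  next
    fix f g assume "f \<in> Q0" "g \<in> Q0"
    then obtain c d where "f \<in> Q" "g \<in> Q"
      "f = (\<lambda>x. \<Sum>i<n. c i * b i x)" "g = (\<lambda>x. \<Sum>i<n. d i * b i x)"
      by (auto simp: Q0_def)
    then show "(\<lambda>x. f x + g x) \<in> Q0"
      unfolding Q0_def using Suc.prems(1) lin_closed_add[of Q f g]
      by (auto intro!: exI[of _ "\<lambda>i. c i + d i"] simp: sum.distrib algebra_simps)
  next
    fix k f assume "f \<in> Q0"
    then obtain c where "f \<in> Q" "f = (\<lambda>x. \<Sum>i<n. c i * b i x)"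
      by (auto simp: Q0_def)
    then show "(\<lambda>x. k * f x) \<in> Q0"
      unfolding Q0_def using Suc.prems(1) lin_closed_scale[of Q f k]
      by (auto intro!: exI[of _ "\<lambda>i. k * c i"] simp: sum_distrib_left algebra_simps)
  qed
  moreover have "Q0 \<subseteq> P" "\<And>f. f \<in> Q0 \<Longrightarrow> \<exists>c. f = (\<lambda>x. \<Sum>i<n. c i * b i x)"
    using Suc.prems(2) by (auto simp: Q0_def)
  ultimately obtain N e where e: "orthonormal N e" "\<forall>i<N. e i \<in> Q0"
    "\<forall>f\<in>Q0. \<exists>a. \<forall>x\<in>space M. f x = (\<Sum>i<N. a i * e i x)"
    using Suc.IH by blast
  have eQ: "e i \<in> Q" if "i < N" for i using e(2) that by (simp add: Q0_def)
  show ?case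
  proof (cases "\<forall>f\<in>Q. \<exists>a. \<forall>x\<in>space M. f x = (\<Sum>i<N. a i * e i x)")
    case True
    then show ?thesis
      using e(1) eQ by blast
  next
    case False
    then obtain g where g: "g \<in> Q" "\<And>a. \<exists>x\<in>space M. g x \<noteq> (\<Sum>i<N. a i * e i x)" by auto
    define p where "p i = (LINT x|M. g x * cnj (e i x))" for i
    define h where "h = (\<lambda>x. g x - (\<Sum>i<N. p i * e i x))"
    have "h \<in> Q"
      unfolding h_def using Suc.prems(1) g(1) eQ
      by (intro lin_closed_diff lin_closed_sum lin_closed_scale) auto
    then have hP: "h \<in> P" using Suc.prems(2) by auto
    have he: "(LINT x|M. h x * cnj (e j x)) = 0" if j: "j < N" for j
    proof -
      have "integrable M (\<lambda>x. g x * cnj (e j x))"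
        "integrable M (\<lambda>x. (\<Sum>i<N. p i * e i x) * cnj (e j x))"
        using j g(1) eQ Suc.prems(1,2)
        by (intro integrable_inner subsetD[OF Suc.prems(2)] lin_closed_sum lin_closed_scale; simp)+
      then have "(LINT x|M. h x * cnj (e j x)) =
          (LINT x|M. g x * cnj (e j x)) - (LINT x|M. (\<Sum>i<N. p i * e i x) * cnj (e j x))"
        unfolding h_def left_diff_distrib by (rule Bochner_Integration.integral_diff)
      then show ?thesis
        using orthonormal_coeff[OF e(1) refl j, of p] by (simp add: p_def)
    qed
    obtain x0 where "x0 \<in> space M" "h x0 \<noteq> 0"
      using g(2)[of p] by (auto simp: h_def)
    then obtain r where r: "0 < r" "(LINT x|M. h x * cnj (h x)) = of_real r"
      using norm_pos[OF hP] by metis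
    define w where "w = (\<lambda>x. of_real (1 / sqrt r) * h x)"
    have wQ: "w \<in> Q" unfolding w_def using Suc.prems(1) \<open>h \<in> Q\<close> by (rule lin_closed_scale)
    have ww: "(LINT x|M. w x * cnj (w x)) = 1"
    proof -
      have "of_real (1 / sqrt r) * cnj (of_real (1 / sqrt r)) = (of_real (1 / r) :: complex)"
        using r(1) by (simp flip: of_real_mult)
      then have "w x * cnj (w x) = of_real (1 / r) * (h x * cnj (h x))" for x
        unfolding w_def by (metis (no_types, lifting) complex_cnj_mult mult.assoc mult.left_commute)
      then show ?thesis
        using r by (simp flip: of_real_mult)
    qed
    have we: "(LINT x|M. w x * cnj (e j x)) = 0" if "j < N" for j
      using he[OF that] by (simp only: w_def mult.assoc integral_mult_right_zero) simp
    have ew: "(LINT x|M. e j x * cnj (w x)) = 0" if "j < N" for j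
    proof -
      have "(LINT x|M. e j x * cnj (w x)) = (LINT x|M. cnj (w x * cnj (e j x)))"
        by (simp add: mult.commute)
      also have "\<dots> = 0" using we[OF that] by (simp only: Bochner_Integration.integral_cnj) simp
      finally show ?thesis .
    qed
    define e' where "e' = e(N := w)"
    have e'Q: "e' i \<in> Q" if "i < Suc N" for i
      using that wQ eQ[of i] by (cases "i = N") (auto simp: e'_def)
    have "(LINT x|M. e' i x * cnj (e' j x)) = (if i = j then 1 else 0)"
      if "i < Suc N" "j < Suc N" for i j
      using that ww we[of j] ew[of i] e(1) by (auto simp: e'_def less_Suc_eq orthonormal_def)
    then have on: "orthonormal (Suc N) e'"
      using e'Q Suc.prems(2) by (auto simp: orthonormal_def)
    obtain d where d: "g = (\<lambda>x. \<Sum>i<Suc n. d i * b i x)"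
      using Suc.prems(3)[OF g(1)] by auto
    have "g \<notin> Q0" using e(3) g(2) by blast
    then have "d n \<noteq> 0" using g(1) d by (auto simp: Q0_def)
    have "\<exists>a. \<forall>x\<in>space M. f x = (\<Sum>i<Suc N. a i * e' i x)" if f: "f \<in> Q" for f
    proof -
      obtain c where c: "f = (\<lambda>x. \<Sum>i<Suc n. c i * b i x)"
        using Suc.prems(3)[OF f] by auto
      define k where "k = c n / d n"
      \<comment> \<open>Subtracting this multiple of \<open>g\<close> cancels the last spanning function.\<close>
      have hQ0: "(\<lambda>x. f x - k * g x) \<in> Q0"
        unfolding Q0_def
      proof (intro CollectI conjI)
        show "(\<lambda>x. f x - k * g x) \<in> Q"
          using Suc.prems(1) f g(1) by (intro lin_closed_diff lin_closed_scale)
        have "f x - k * g x = (\<Sum>i<n. (c i - k * d i) * b i x)" for x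
          using \<open>d n \<noteq> 0\<close>
          by (simp add: c d k_def algebra_simps sum_subtractf sum_distrib_left)
        then show "\<exists>c. (\<lambda>x. f x - k * g x) = (\<lambda>x. \<Sum>i<n. c i * b i x)"
          by (intro exI[of _ "\<lambda>i. c i - k * d i"]) auto
      qed
      then obtain a where a: "\<And>x. x \<in> space M \<Longrightarrow> f x - k * g x = (\<Sum>i<N. a i * e i x)"
        using bspec[OF e(3) hQ0] by auto
      have gw: "g x = of_real (sqrt r) * w x + (\<Sum>i<N. p i * e i x)" for x
        using r(1) by (simp add: w_def h_def flip: mult.assoc)
      have "f x = (\<Sum>i<Suc N. (if i = N then k * of_real (sqrt r) else a i + k * p i) * e' i x)"
        if "x \<in> space M" for x
      proof -
        have "f x = (\<Sum>i<N. a i * e i x) + k * g x"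
          using a[OF that] by (simp add: algebra_simps)
        also have "\<dots> = (\<Sum>i<N. (a i + k * p i) * e i x) + k * of_real (sqrt r) * w x"
          by (simp add: gw algebra_simps sum.distrib sum_distrib_left)
        also have "\<dots> = (\<Sum>i<Suc N. (if i = N then k * of_real (sqrt r) else a i + k * p i) * e' i x)"
          by (simp add: e'_def)
        finally show ?thesis .
      qed
      then show ?thesis
        by (intro exI[of _ "\<lambda>i. if i = N then k * of_real (sqrt r) else a i + k * p i"]) blast
    qed
    with on e'Q show ?thesis by blast
  qed
qed

text \<open>
  The classical formula for the reproducing kernel. It shows at the same time that the function described by
  the definite description in \<open>reproducing_kernel\<close> exists; it is unique since the inner
  product is definite.
\<close>

lemma (in kernel_space) reproducing_kernel_eq:
  assumes e: "orthonormal N e"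
    and span: "\<And>f. f \<in> P \<Longrightarrow> \<exists>a. \<forall>x\<in>space M. f x = (\<Sum>i<N. a i * e i x)"
    and w: "w \<in> space M" and x: "x \<in> space M"
  shows "reproducing_kernel M ((\<lambda>f. restrict f (space M)) ` P) w x = (\<Sum>i<N. cnj (e i w) * e i x)"
proof -
  let ?H = "(\<lambda>f. restrict f (space M)) ` P"
  define K where "K = (\<lambda>x. \<Sum>i<N. cnj (e i w) * e i x)"
  have eP: "e i \<in> P" if "i < N" for i using e that by (simp add: orthonormal_def)
  have K: "K \<in> P"
    unfolding K_def using lin eP by (intro lin_closed_sum lin_closed_scale) auto
  have int_restrict: "(LINT x|M. restrict f (space M) x * cnj (restrict g (space M) x)) =
      (LINT x|M. f x * cnj (g x))" for f g
    by (intro Bochner_Integration.integral_cong) auto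
  have K_repr: "f w = (LINT x|M. f x * cnj (K x))" if f: "f \<in> P" for f
  proof -
    have "(LINT x|M. f x * cnj (K x)) = (LINT x|M. (\<Sum>i<N. e i w * (f x * cnj (e i x))))"
      by (simp add: K_def sum_distrib_left mult_ac)
    also have "\<dots> = (\<Sum>i<N. e i w * (LINT x|M. f x * cnj (e i x)))"
      using f eP by (subst Bochner_Integration.integral_sum) (auto intro!: integrable_inner)
    also have "\<dots> = f w"
      using span[OF f] orthonormal_coeff[OF e] w by (auto simp: mult.commute)
    finally show ?thesis by simp
  qed
  have "reproducing_kernel M ?H w = restrict K (space M)"
    unfolding reproducing_kernel_def
  proof (rule the_equality)
    have restrict_w: "restrict f (space M) w = f w" for f :: "'a \<Rightarrow> complex"
      using w by simp
    show "restrict K (space M) \<in> ?H \<and> (\<forall>Y\<in>?H. Y w = (LINT z|M. Y z * cnj (restrict K (space M) z)))"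
      using K K_repr by (auto simp: int_restrict restrict_w simp del: restrict_apply)
  next
    fix Z assume Z: "Z \<in> ?H \<and> (\<forall>Y\<in>?H. Y w = (LINT z|M. Y z * cnj (Z z)))"
    then obtain L where L: "L \<in> P" "Z = restrict L (space M)" by auto
    have L_repr: "f w = (LINT x|M. f x * cnj (L x))" if "f \<in> P" for f
    proof -
      have "restrict f (space M) w = (LINT x|M. restrict f (space M) x * cnj (Z x))"
        using Z that by blast
      then show ?thesis
        unfolding L(2) int_restrict using w by simp
    qed
    have D: "(\<lambda>x. L x - K x) \<in> P"
      using lin L(1) K by (rule lin_closed_diff)
    have "(LINT x|M. (L x - K x) * cnj (L x - K x)) =
        (LINT x|M. (L x - K x) * cnj (L x)) - (LINT x|M. (L x - K x) * cnj (K x))"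
      unfolding complex_cnj_diff right_diff_distrib
      by (intro Bochner_Integration.integral_diff integrable_inner D L K)
    also have "\<dots> = 0"
      using L_repr[OF D] K_repr[OF D] by simp
    finally have "L x - K x = 0" if "x \<in> space M" for x
      using eq_0_if_norm_0[OF D _ that] by simp
    then show "Z = restrict K (space M)"
      by (auto simp: L(2) restrict_def)
  qed
  with x show ?thesis by (simp add: K_def)
qed

text \<open>
  In an orthonormal basis, the integral of \<open>g\<close> against the conjugate of the kernel at \<open>w\<close> is \<open>\<Sum>i. p i * e i w\<close>, where
  \<open>p i\<close> is the inner product of \<open>g\<close> and \<open>e i\<close>. If this vanishes for all \<open>w\<close>, then so do all coefficients \<open>p i\<close>.
\<close>

lemma (in kernel_space) orthogonal_reproducing_kernels_iff:
  fixes b :: "nat \<Rightarrow> 'a \<Rightarrow> complex"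
  assumes fin: "\<And>f. f \<in> P \<Longrightarrow> \<exists>c. f = (\<lambda>x. \<Sum>i<n. c i * b i x)"
    and g: "integrable M g"
  shows "(\<forall>w\<in>space M. (LINT x|M. g x * cnj (reproducing_kernel M ((\<lambda>f. restrict f (space M)) ` P) w x)) = 0)
    \<longleftrightarrow> (\<forall>f\<in>P. (LINT x|M. g x * cnj (f x)) = 0)"
proof -
  obtain N e where e: "orthonormal N e"
    and span: "\<And>f. f \<in> P \<Longrightarrow> \<exists>a. \<forall>x\<in>space M. f x = (\<Sum>i<N. a i * e i x)"
    using ex_orthonormal_basis[OF lin subset_refl fin] by blast
  have eP: "e i \<in> P" if "i < N" for i using e that by (simp add: orthonormal_def)
  define p where "p i = (LINT x|M. g x * cnj (e i x))" for i
  have conv: "(LINT x|M. g x * cnj (reproducing_kernel M ((\<lambda>f. restrict f (space M)) ` P) w x)) =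
      (\<Sum>i<N. p i * e i w)" if "w \<in> space M" for w
  proof -
    have "(LINT x|M. g x * cnj (reproducing_kernel M ((\<lambda>f. restrict f (space M)) ` P) w x)) =
        (LINT x|M. (\<Sum>i<N. e i w * (g x * cnj (e i x))))"
      using reproducing_kernel_eq[OF e span that]
      by (intro Bochner_Integration.integral_cong) (simp_all add: sum_distrib_left mult_ac)
    also have "\<dots> = (\<Sum>i<N. e i w * p i)"
      using g eP by (subst Bochner_Integration.integral_sum) (auto intro!: integrable_mult_cnj simp: p_def)
    finally show ?thesis by (simp add: mult.commute)
  qed
  show ?thesis
  proof
    assume "\<forall>w\<in>space M. (LINT x|M. g x * cnj (reproducing_kernel M ((\<lambda>f. restrict f (space M)) ` P) w x)) = 0"
    then have "(\<Sum>i<N. p i * e i w) = 0" if "w \<in> space M" for w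
      using conv that by simp
    then have p0: "p j = 0" if "j < N" for j
      using orthonormal_coeff[OF e _ that, of "\<lambda>_. 0" p] by simp
    show "\<forall>f\<in>P. (LINT x|M. g x * cnj (f x)) = 0"
    proof
      fix f assume "f \<in> P"
      then obtain a where a: "\<And>x. x \<in> space M \<Longrightarrow> f x = (\<Sum>i<N. a i * e i x)"
        using span by blast
      have "(LINT x|M. g x * cnj (f x)) = (LINT x|M. (\<Sum>i<N. cnj (a i) * (g x * cnj (e i x))))"
        using a by (intro Bochner_Integration.integral_cong) (simp_all add: sum_distrib_left mult_ac)
      also have "\<dots> = (\<Sum>i<N. cnj (a i) * p i)"
        using g eP by (subst Bochner_Integration.integral_sum) (auto intro!: integrable_mult_cnj simp: p_def)
      finally show "(LINT x|M. g x * cnj (f x)) = 0" using p0 by simp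
    qed
  next
    assume "\<forall>f\<in>P. (LINT x|M. g x * cnj (f x)) = 0"
    then have "p i = 0" if "i < N" for i
      using eP[OF that] by (simp add: p_def)
    then show "\<forall>w\<in>space M. (LINT x|M. g x * cnj (reproducing_kernel M ((\<lambda>f. restrict f (space M)) ` P) w x)) = 0"
      using conv by simp
  qed
qed

text \<open>
  The left side is the condition at one index in the definition of a multiplier. The right
  side is linear in the space \<open>P\<close>, so it can be compared across different decompositions
  of the same space of functions.
\<close>

lemma (in kernel_space) multiplier_iff_orthogonal:
  fixes b :: "nat \<Rightarrow> 'a \<Rightarrow> complex"
  assumes fin: "\<And>f. f \<in> P \<Longrightarrow> \<exists>c. f = (\<lambda>x. \<Sum>i<n. c i * b i x)"
    and g: "integrable M g" and h: "integrable M h"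
  defines "Z \<equiv> reproducing_kernel M ((\<lambda>f. restrict f (space M)) ` P)"
  shows "(\<forall>w\<in>space M. (LINT x|M. g x * cnj (Z w x)) = l * (LINT x|M. h x * cnj (Z w x)))
    \<longleftrightarrow> (\<forall>f\<in>P. (LINT x|M. (g x - l * h x) * cnj (f x)) = 0)"
proof -
  obtain N e where e: "orthonormal N e"
    and span: "\<And>f. f \<in> P \<Longrightarrow> \<exists>a. \<forall>x\<in>space M. f x = (\<Sum>i<N. a i * e i x)"
    using ex_orthonormal_basis[OF lin subset_refl fin] by blast
  have eP: "e i \<in> P" if "i < N" for i using e that by (simp add: orthonormal_def)
  have d: "integrable M (\<lambda>x. g x - l * h x)" using g h by simp
  have conv: "(LINT x|M. g x * cnj (Z w x)) - l * (LINT x|M. h x * cnj (Z w x)) =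
      (LINT x|M. (g x - l * h x) * cnj (Z w x))" if w: "w \<in> space M" for w
  proof -
    define K where "K = (\<lambda>x. \<Sum>i<N. cnj (e i w) * e i x)"
    have K: "K \<in> P" unfolding K_def using lin eP by (intro lin_closed_sum lin_closed_scale) auto
    have Z: "Z w x = K x" if "x \<in> space M" for x
      unfolding Z_def K_def using e span w that by (rule reproducing_kernel_eq)
    have eq: "(LINT x|M. k x * cnj (Z w x)) = (LINT x|M. k x * cnj (K x))" for k
      by (intro Bochner_Integration.integral_cong) (simp_all add: Z)
    have "(LINT x|M. (g x - l * h x) * cnj (K x)) =
        (LINT x|M. g x * cnj (K x) - l * (h x * cnj (K x)))"
      by (simp add: left_diff_distrib mult.assoc)
    also have "\<dots> = (LINT x|M. g x * cnj (K x)) - l * (LINT x|M. h x * cnj (K x))"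
      using integrable_mult_cnj[OF g K] integrable_mult_cnj[OF h K] by simp
    finally show ?thesis by (simp only: eq)
  qed
  have "(\<forall>w\<in>space M. (LINT x|M. g x * cnj (Z w x)) = l * (LINT x|M. h x * cnj (Z w x))) \<longleftrightarrow>
      (\<forall>w\<in>space M. (LINT x|M. (g x - l * h x) * cnj (Z w x)) = 0)"
    by (simp flip: conv)
  also have "\<dots> \<longleftrightarrow> (\<forall>f\<in>P. (LINT x|M. (g x - l * h x) * cnj (f x)) = 0)"
    unfolding Z_def using fin d by (rule orthogonal_reproducing_kernels_iff)
  finally show ?thesis .
qed

lemma (in measure_iso) kernel_space_pullback:
  assumes N: "kernel_space N Q" and P: "lin_closed P" "\<And>f. f \<in> P \<Longrightarrow> \<exists>F\<in>Q. f = F \<circ> u"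
  shows "kernel_space M P"
proof -
  interpret N: kernel_space N Q by (rule N)
  have "space M \<in> sets M" by simp
  from emeasure_image[OF this] N.emeasure_finite[of "space N"]
  have "finite_measure M"
    by (intro finite_measureI) (simp add: space_image)
  then interpret finite_measure M .
  show ?thesis
  proof
    show "lin_closed P" by (rule P)
    fix f assume "f \<in> P"
    then obtain F where F: "F \<in> Q" "f = F \<circ> u" using P(2) by blast
    show "f \<in> borel_measurable M"
      using N.meas[OF F(1)] borel_measurable_iff[of F] by (simp add: F(2))
    show "\<exists>C. \<forall>x\<in>space M. cmod (f x) \<le> C"
      using N.bdd[OF F(1)] by (auto simp: F(2) simp flip: space_image)
    fix x assume x: "AE x in M. f x = 0" "x \<in> space M"
    then have "AE y in N. F y = 0"
      by (simp add: AE_iff F(2))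
    then show "f x = 0"
      using N.definite[OF F(1), of "u x"] x(2) by (auto simp: F(2) simp flip: space_image)
  qed
qed

section \<open>Derivatives of polynomial functions\<close>

text \<open>
  Polynomial functions without reference to coordinates, closed under directional derivatives. Directional derivatives of
  these are computed by structural induction, and \<open>polyfun\<close> is stable under linear substitutions.
\<close>

inductive_set polyfun :: "('e::real_normed_vector \<Rightarrow> complex) set" where
  const: "(\<lambda>_. c) \<in> polyfun"
| linear: "bounded_linear l \<Longrightarrow> l \<in> polyfun"
| add: "\<lbrakk>f \<in> polyfun; g \<in> polyfun\<rbrakk> \<Longrightarrow> (\<lambda>x. f x + g x) \<in> polyfun"
| mult: "\<lbrakk>f \<in> polyfun; g \<in> polyfun\<rbrakk> \<Longrightarrow> (\<lambda>x. f x * g x) \<in> polyfun"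

text \<open>
  For a differentiable function the curve-wise derivative in \<open>dir_deriv\<close> is the
  value of the total derivative; in particular it is linear in the direction.
\<close>

lemma polyfun_has_derivative:
  assumes "f \<in> polyfun"
  shows "(f has_derivative (\<lambda>v. dir_deriv v f x)) (at x)"
proof -
  have *: "(f has_derivative (\<lambda>v. dir_deriv v f x)) (at x)" if "(f has_derivative D) (at x)" for D
  proof -
    have "dir_deriv v f x = D v" for v
    proof -
      have "((\<lambda>t. x + t *\<^sub>R v) has_vector_derivative v) (at 0)"
        by (auto intro!: derivative_eq_intros simp: has_vector_derivative_def)
      moreover have "(f has_derivative D) (at (x + 0 *\<^sub>R v))"
        using that by simp
      ultimately have "(f \<circ> (\<lambda>t. x + t *\<^sub>R v) has_vector_derivative D v) (at 0)"
        by (rule vector_derivative_diff_chain_within[OF _ has_derivative_at_withinI])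
      then show ?thesis
        by (simp add: dir_deriv_def comp_def vector_derivative_at)
    qed
    then show ?thesis using that by simp
  qed
  from assms have "\<exists>D. (f has_derivative D) (at x)"
  proof induction
    case (const c)
    show ?case using has_derivative_const by blast
  next
    case (linear l)
    then show ?case using bounded_linear_imp_has_derivative by blast
  next
    case (add f g)
    then show ?case using has_derivative_add by blast
  next
    case (mult f g)
    then show ?case using has_derivative_mult by blast
  qed
  then show ?thesis using * by blast
qed

lemma dir_deriv_eqI:
  assumes "f \<in> polyfun" "(f has_derivative D) (at x)"
  shows "dir_deriv v f x = D v"
  using has_derivative_unique[OF polyfun_has_derivative[OF assms(1)] assms(2)] by metis

lemma dir_deriv_const [simp]: "dir_deriv v (\<lambda>_. c) = (\<lambda>_. 0)"
  by (rule ext) (simp add: dir_deriv_def)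

lemma dir_deriv_linear:
  assumes "bounded_linear l"
  shows "dir_deriv v l = (\<lambda>_. l v)"
  by (rule ext, rule dir_deriv_eqI)
    (auto intro: polyfun.linear assms bounded_linear_imp_has_derivative)

lemma dir_deriv_add:
  assumes "f \<in> polyfun" "g \<in> polyfun"
  shows "dir_deriv v (\<lambda>x. f x + g x) = (\<lambda>x. dir_deriv v f x + dir_deriv v g x)"
  by (rule ext, rule dir_deriv_eqI)
    (intro polyfun.add has_derivative_add polyfun_has_derivative assms)+

lemma dir_deriv_mult:
  assumes "f \<in> polyfun" "g \<in> polyfun"
  shows "dir_deriv v (\<lambda>x. f x * g x) = (\<lambda>x. f x * dir_deriv v g x + dir_deriv v f x * g x)"
  by (rule ext, rule dir_deriv_eqI)
    (intro polyfun.mult has_derivative_mult polyfun_has_derivative assms)+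

lemma dir_deriv_polyfun:
  assumes "f \<in> polyfun" shows "dir_deriv v f \<in> polyfun"
  using assms by induction
    (auto simp: dir_deriv_linear dir_deriv_add dir_deriv_mult intro: polyfun.intros)

lemma dir_deriv_cmult:
  assumes "f \<in> polyfun"
  shows "dir_deriv v (\<lambda>x. c * f x) = (\<lambda>x. c * dir_deriv v f x)"
  using dir_deriv_mult[OF polyfun.const assms] by simp

lemma dir_deriv_combine:
  assumes "f \<in> polyfun"
  shows "dir_deriv (a *\<^sub>R v + b *\<^sub>R w) f = (\<lambda>x. of_real a * dir_deriv v f x + of_real b * dir_deriv w f x)"
proof
  fix x
  have lin: "linear (\<lambda>v. dir_deriv v f x)"
    using polyfun_has_derivative[OF assms] by (rule has_derivative_linear)
  show "dir_deriv (a *\<^sub>R v + b *\<^sub>R w) f x = of_real a * dir_deriv v f x + of_real b * dir_deriv w f x"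
    by (simp only: linear_add[OF lin] linear_scale[OF lin] scaleR_conv_of_real)
qed

lemma dir_deriv_commute:
  assumes "f \<in> polyfun"
  shows "dir_deriv v (dir_deriv w f) = dir_deriv w (dir_deriv v f)"
  using assms
proof induction
  case (add f g)
  then show ?case by (simp add: dir_deriv_add dir_deriv_polyfun)
next
  case (mult f g)
  then show ?case
    by (simp add: dir_deriv_add dir_deriv_mult dir_deriv_polyfun polyfun.mult algebra_simps)
qed (simp_all add: dir_deriv_linear)

text \<open>
  Directly from the definition, as \<open>L\<close> maps lines to lines.
\<close>

lemma dir_deriv_comp_linear:
  assumes "linear L"
  shows "dir_deriv v (\<lambda>x. f (L x)) = (\<lambda>x. dir_deriv (L v) f (L x))"
  using assms by (simp add: fun_eq_iff dir_deriv_def linear_add linear_scale)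

lemma polyfun_sum:
  assumes "\<And>i. i \<in> I \<Longrightarrow> f i \<in> polyfun"
  shows "(\<lambda>x. \<Sum>i\<in>I. f i x) \<in> polyfun"
  using assms by (induction I rule: infinite_finite_induct) (auto intro: polyfun.intros)

lemma polyfun_prod:
  assumes "\<And>i. i \<in> I \<Longrightarrow> f i \<in> polyfun"
  shows "(\<lambda>x. \<Prod>i\<in>I. f i x) \<in> polyfun"
  using assms by (induction I rule: infinite_finite_induct) (auto intro: polyfun.intros)

lemma polyfun_power:
  assumes "f \<in> polyfun"
  shows "(\<lambda>x. f x ^ n) \<in> polyfun"
  using assms by (induction n) (auto intro: polyfun.intros)

lemma polyfun_cmult: "f \<in> polyfun \<Longrightarrow> (\<lambda>x. c * f x) \<in> polyfun"
  by (rule polyfun.mult[OF polyfun.const])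

lemma polyfun_continuous: "f \<in> polyfun \<Longrightarrow> continuous_on S f"
  by (induction rule: polyfun.induct) (auto intro: continuous_intros linear_continuous_on)

lemma polyfun_comp_linear:
  assumes "f \<in> polyfun" "bounded_linear L"
  shows "(\<lambda>x. f (L x)) \<in> polyfun"
  using assms by induction (auto intro: polyfun.intros bounded_linear_compose)

lemma dir_deriv_sum_cmult:
  assumes "\<And>i. i \<in> I \<Longrightarrow> f i \<in> polyfun"
  shows "dir_deriv v (\<lambda>x. \<Sum>i\<in>I. c i * f i x) = (\<lambda>x. \<Sum>i\<in>I. c i * dir_deriv v (f i) x)"
  using assms by (induction I rule: infinite_finite_induct)
    (auto simp: dir_deriv_add dir_deriv_cmult polyfun_cmult polyfun_sum)

lemma laplacian_sum_cmult:
  assumes "\<And>i. i \<in> I \<Longrightarrow> f i \<in> polyfun"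
  shows "laplacian (\<lambda>x. \<Sum>i\<in>I. c i * f i x) x = (\<Sum>i\<in>I. c i * laplacian (f i) x)"
  unfolding laplacian_def sum_distrib_left
  by (subst sum.swap) (simp add: dir_deriv_sum_cmult assms dir_deriv_polyfun)

lemma linear_Upsilon: "linear (Upsilon :: complex ^ 'd \<Rightarrow> _)"
  by (rule linearI) (auto simp: Upsilon_def vec_eq_iff)

lemma Upsilon_axis:
  "Upsilon (axis j 1 :: complex ^ 'd) = axis (j, 1) 1"
  "Upsilon (axis j \<i> :: complex ^ 'd) = axis (j, 2) 1"
proof -
  have "i = 1 \<or> i = 2" for i :: 2 by (rule exhaust_2)
  then have "(i \<noteq> 1) = (i = 2)" for i :: 2 by force
  then show "Upsilon (axis j 1 :: complex ^ 'd) = axis (j, 1) 1"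
    "Upsilon (axis j \<i> :: complex ^ 'd) = axis (j, 2) 1"
    by (simp_all add: Upsilon_def vec_eq_iff axis_def)
qed

text \<open>
  In the product \<open>(\<partial>\<^sub>x - \<i> \<partial>\<^sub>y) (\<partial>\<^sub>x + \<i> \<partial>\<^sub>y)\<close> the mixed terms cancel because derivatives in different
  directions commute.
\<close>

lemma complex_laplacian_eq:
  assumes "f \<in> polyfun"
  shows "complex_laplacian f z =
    (\<Sum>j\<in>UNIV. dir_deriv (axis j 1) (dir_deriv (axis j 1) f) z +
                dir_deriv (axis j \<i>) (dir_deriv (axis j \<i>) f) z)"
proof -
  have "4 * d_z j (d_zbar j f) z = dir_deriv (axis j 1) (dir_deriv (axis j 1) f) z +
                dir_deriv (axis j \<i>) (dir_deriv (axis j \<i>) f) z" for j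
  proof -
    have zbar: "d_zbar j f = (\<lambda>z. (1 / 2) * dir_deriv (axis j 1) f z + (\<i> / 2) * dir_deriv (axis j \<i>) f z)"
      by (simp add: fun_eq_iff d_zbar_def add_divide_distrib)
    have "dir_deriv v (d_zbar j f) z = (1 / 2) * dir_deriv v (dir_deriv (axis j 1) f) z +
        (\<i> / 2) * dir_deriv v (dir_deriv (axis j \<i>) f) z" for v
      using assms unfolding zbar
      by (simp only: dir_deriv_add dir_deriv_cmult dir_deriv_polyfun polyfun_cmult)
    moreover have "dir_deriv (axis j \<i>) (dir_deriv (axis j 1) f) = dir_deriv (axis j 1) (dir_deriv (axis j \<i>) f)"
      using assms by (rule dir_deriv_commute)
    ultimately show ?thesis
      by (simp add: d_z_def algebra_simps add_divide_distrib)
  qed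
  then show ?thesis
    by (simp add: complex_laplacian_def sum_distrib_left)
qed

lemma complex_laplacian_sum_cmult:
  assumes "\<And>i. i \<in> I \<Longrightarrow> f i \<in> polyfun"
  shows "complex_laplacian (\<lambda>x. \<Sum>i\<in>I. c i * f i x) z = (\<Sum>i\<in>I. c i * complex_laplacian (f i) z)"
proof -
  have "(\<Sum>i\<in>I. c i * complex_laplacian (f i) z) =
      (\<Sum>i\<in>I. \<Sum>j\<in>UNIV. c i * dir_deriv (axis j 1) (dir_deriv (axis j 1) (f i)) z +
                        c i * dir_deriv (axis j \<i>) (dir_deriv (axis j \<i>) (f i)) z)"
    using assms by (intro sum.cong refl) (simp add: complex_laplacian_eq sum_distrib_left distrib_left)
  also have "\<dots> = complex_laplacian (\<lambda>x. \<Sum>i\<in>I. c i * f i x) z"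
    using assms by (subst sum.swap)
      (simp add: complex_laplacian_eq polyfun_sum polyfun_cmult dir_deriv_sum_cmult dir_deriv_polyfun sum.distrib)
  finally show ?thesis by simp
qed

lemma complex_laplacian_Upsilon:
  assumes "f \<in> polyfun"
  shows "complex_laplacian (\<lambda>z. f (Upsilon z)) z = laplacian f (Upsilon z)"
proof -
  have "(\<lambda>z. f (Upsilon z)) \<in> polyfun"
    using assms linear_conv_bounded_linear[THEN iffD1, OF linear_Upsilon] by (rule polyfun_comp_linear)
  then have "complex_laplacian (\<lambda>z. f (Upsilon z)) z =
      (\<Sum>j\<in>UNIV. dir_deriv (axis (j, 1) 1) (dir_deriv (axis (j, 1) 1) f) (Upsilon z) +
                  dir_deriv (axis (j, 2) 1) (dir_deriv (axis (j, 2) 1) f) (Upsilon z))"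
    by (simp add: complex_laplacian_eq dir_deriv_comp_linear[OF linear_Upsilon] Upsilon_axis)
  also have "\<dots> = (\<Sum>j\<in>UNIV. \<Sum>i\<in>UNIV. dir_deriv (axis (j, i) 1) (dir_deriv (axis (j, i :: 2) 1) f) (Upsilon z))"
    by (simp add: UNIV_2)
  also have "\<dots> = laplacian f (Upsilon z)"
    unfolding laplacian_def by (simp add: sum.cartesian_product flip: UNIV_Times_UNIV)
  finally show ?thesis .
qed

text \<open>
  Multiplication by \<open>w\<close> rotates each coordinate plane, and the Laplacian of the plane is
  invariant under rotations.
\<close>

lemma complex_laplacian_rotate:
  fixes f :: "complex ^ 'd \<Rightarrow> complex"
  assumes f: "f \<in> polyfun" and w: "cmod w = 1"
  shows "complex_laplacian (\<lambda>z. f (w *s z)) z = complex_laplacian f (w *s z)"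
proof -
  let ?a = "Re w" and ?b = "Im w"
  have lin: "linear (\<lambda>z :: complex ^ 'd. w *s z)"
    by (rule linearI) (auto simp: vec_eq_iff algebra_simps)
  have ax: "w *s axis j 1 = ?a *\<^sub>R axis j 1 + ?b *\<^sub>R axis j \<i>"
      "w *s axis j \<i> = (- ?b) *\<^sub>R axis j 1 + ?a *\<^sub>R axis j \<i>" for j :: 'd
    by (auto simp: vec_eq_iff axis_def complex_eq_iff)
  have sq: "of_real ?a * of_real ?a + of_real ?b * of_real ?b = (1 :: complex)"
    using w by (simp add: cmod_def power2_eq_square flip: of_real_mult of_real_add)
  have "dir_deriv (w *s axis j 1) (dir_deriv (w *s axis j 1) f) x +
        dir_deriv (w *s axis j \<i>) (dir_deriv (w *s axis j \<i>) f) x =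
      dir_deriv (axis j 1) (dir_deriv (axis j 1) f) x +
        dir_deriv (axis j \<i>) (dir_deriv (axis j \<i>) f) x" for j x
  proof -
    let ?D = "\<lambda>u v. dir_deriv (axis j u) (dir_deriv (axis j v) f) x"
    have D: "dir_deriv (r *\<^sub>R axis j 1 + s *\<^sub>R axis j \<i>) (dir_deriv (r *\<^sub>R axis j 1 + s *\<^sub>R axis j \<i>) f) x =
        of_real r * (of_real r * ?D 1 1 + of_real s * ?D 1 \<i>) +
        of_real s * (of_real r * ?D 1 \<i> + of_real s * ?D \<i> \<i>)" for r s
      using f dir_deriv_commute[OF f, of "axis j \<i>" "axis j 1"]
      by (simp add: dir_deriv_combine dir_deriv_polyfun dir_deriv_add dir_deriv_cmult polyfun_cmult polyfun.add)
    have "(of_real ?a * of_real ?a + of_real ?b * of_real ?b) * ?D 1 1 +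
        (of_real ?a * of_real ?a + of_real ?b * of_real ?b) * ?D \<i> \<i> = ?D 1 1 + ?D \<i> \<i>"
      by (simp only: sq mult_1)
    then show ?thesis
      unfolding ax D by (simp add: algebra_simps)
  qed
  moreover have "(\<lambda>z. f (w *s z)) \<in> polyfun"
    using f linear_conv_bounded_linear[THEN iffD1, OF lin] by (rule polyfun_comp_linear)
  ultimately show ?thesis
    using f by (simp add: complex_laplacian_eq dir_deriv_comp_linear[OF lin])
qed

text \<open>
  Both statements are proved together because the product rule for \<open>cnj (f x) * cnj (g x)\<close> needs the factors to be
  polynomial.
\<close>

lemma polyfun_cnj_and_dir_deriv_cnj:
  assumes "f \<in> polyfun"
  shows "(\<lambda>x. cnj (f x)) \<in> polyfun \<and> dir_deriv v (\<lambda>x. cnj (f x)) = (\<lambda>x. cnj (dir_deriv v f x))"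
  using assms
proof induction
  case (linear l)
  then have "bounded_linear (\<lambda>x. cnj (l x))"
    by (rule bounded_linear_compose[OF bounded_linear_cnj])
  with linear show ?case
    by (simp add: polyfun.linear dir_deriv_linear)
qed (simp_all add: polyfun.intros dir_deriv_add dir_deriv_mult)

lemma polyfun_cnj: "f \<in> polyfun \<Longrightarrow> (\<lambda>x. cnj (f x)) \<in> polyfun"
  and dir_deriv_cnj: "f \<in> polyfun \<Longrightarrow> dir_deriv v (\<lambda>x. cnj (f x)) = (\<lambda>x. cnj (dir_deriv v f x))"
  using polyfun_cnj_and_dir_deriv_cnj by blast+

lemma complex_laplacian_cnj:
  assumes "f \<in> polyfun"
  shows "complex_laplacian (\<lambda>z. cnj (f z)) z = cnj (complex_laplacian f z)"
  using assms by (simp add: complex_laplacian_eq polyfun_cnj dir_deriv_cnj dir_deriv_polyfun)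

section \<open>Homogeneous and bihomogeneous polynomials\<close>

text \<open>
  The coordinate form in which both kinds of polynomials are given: linear combinations of
  a family of monomials indexed by a finite set.
\<close>

definition fin_span :: "'i set \<Rightarrow> ('i \<Rightarrow> 'a \<Rightarrow> complex) \<Rightarrow> ('a \<Rightarrow> complex) set" where
  "fin_span A m = {f. \<exists>c. f = (\<lambda>x. \<Sum>a\<in>A. c a * m a x)}"

lemma lin_closed_fin_span: "lin_closed (fin_span A m)"
  unfolding lin_closed_def
proof (intro conjI ballI allI)
  show "(\<lambda>_. 0) \<in> fin_span A m"
    by (auto simp: fin_span_def intro!: exI[of _ "\<lambda>_. 0"])
next
  fix f g assume "f \<in> fin_span A m" "g \<in> fin_span A m"
  then obtain c d where "f = (\<lambda>x. \<Sum>a\<in>A. c a * m a x)" "g = (\<lambda>x. \<Sum>a\<in>A. d a * m a x)"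
    by (auto simp: fin_span_def)
  then show "(\<lambda>x. f x + g x) \<in> fin_span A m"
    by (auto simp: fin_span_def sum.distrib algebra_simps intro!: exI[of _ "\<lambda>a. c a + d a"])
next
  fix k f assume "f \<in> fin_span A m"
  then obtain c where "f = (\<lambda>x. \<Sum>a\<in>A. c a * m a x)"
    by (auto simp: fin_span_def)
  then show "(\<lambda>x. k * f x) \<in> fin_span A m"
    by (auto simp: fin_span_def sum_distrib_left algebra_simps intro!: exI[of _ "\<lambda>a. k * c a"])
qed

lemma fin_span_base:
  assumes "finite A" "a \<in> A"
  shows "m a \<in> fin_span A m"
proof -
  have "m a = (\<lambda>x. \<Sum>b\<in>A. (if b = a then 1 else 0) * m b x)"
    using assms by (simp add: fun_eq_iff if_distrib[of "\<lambda>u. u * _"] cong: if_cong)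
  then show ?thesis
    unfolding fin_span_def by (intro CollectI exI)
qed

lemma fin_span_mult:
  assumes P: "lin_closed P" "\<And>a b. a \<in> A \<Longrightarrow> b \<in> B \<Longrightarrow> (\<lambda>x. m a x * k b x) \<in> P"
    and f: "f \<in> fin_span A m" and g: "g \<in> fin_span B k"
  shows "(\<lambda>x. f x * g x) \<in> P"
proof -
  obtain c d where cd: "f = (\<lambda>x. \<Sum>a\<in>A. c a * m a x)" "g = (\<lambda>x. \<Sum>b\<in>B. d b * k b x)"
    using f g by (auto simp: fin_span_def)
  have "(\<lambda>x. f x * g x) = (\<lambda>x. \<Sum>a\<in>A. \<Sum>b\<in>B. (c a * d b) * (m a x * k b x))"
    by (simp add: cd sum_product mult_ac)
  also have "\<dots> \<in> P"
    using P by (intro lin_closed_sum lin_closed_scale)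
  finally show ?thesis .
qed

lemma fin_span_enum:
  fixes A :: "'i set" and m :: "'i \<Rightarrow> 'a \<Rightarrow> complex"
  assumes "finite A"
  shows "\<exists>b n. \<forall>f\<in>fin_span A m. \<exists>c. f = (\<lambda>x. \<Sum>i<n::nat. c i * b i x)"
proof -
  obtain h where h: "bij_betw h {0..<card A} A"
    using ex_bij_betw_nat_finite[OF assms] by auto
  have "\<exists>c. f = (\<lambda>x. \<Sum>i<card A. c i * m (h i) x)" if f: "f \<in> fin_span A m" for f
  proof -
    obtain c where "f = (\<lambda>x. \<Sum>a\<in>A. c a * m a x)"
      using f by (auto simp: fin_span_def)
    then have "f = (\<lambda>x. \<Sum>i<card A. c (h i) * m (h i) x)"
      using sum.reindex_bij_betw[OF h, of "\<lambda>a. c a * m a _"] by (simp add: atLeast0LessThan)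
    then show ?thesis by (intro exI)
  qed
  then show ?thesis by (intro exI[of _ "\<lambda>i. m (h i)"] exI[of _ "card A"]) blast
qed

text \<open>
  Products of coordinates stay in the degree that they should have. This serves both for
  the homogeneous polynomials and for the sums of bihomogeneous ones.
\<close>

locale graded_functions =
  fixes A :: "nat \<Rightarrow> ('a \<Rightarrow> complex) set"
  assumes one: "(\<lambda>_. 1) \<in> A 0"
    and mult: "\<lbrakk>f \<in> A k; g \<in> A l\<rbrakk> \<Longrightarrow> (\<lambda>x. f x * g x) \<in> A (k + l)"
begin

lemma power: "f \<in> A 1 \<Longrightarrow> (\<lambda>x. f x ^ n) \<in> A n"
  using mult[of f 1 _ ] by (induction n) (auto simp: one)

lemma monomial:
  assumes "finite I" "\<And>i. i \<in> I \<Longrightarrow> f i \<in> A 1"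
  shows "(\<lambda>x. \<Prod>i\<in>I. f i x ^ \<alpha> i) \<in> A (\<Sum>i\<in>I. \<alpha> i)"
  using assms by (induction I) (auto simp: one intro!: mult power)

end

lemma multi_indices_add:
  "\<lbrakk>\<alpha> \<in> multi_indices k; \<beta> \<in> multi_indices l\<rbrakk> \<Longrightarrow> (\<lambda>i. \<alpha> i + \<beta> i) \<in> multi_indices (k + l)"
  by (simp add: multi_indices_def sum.distrib)

lemma zero_multi_indices: "(\<lambda>_. 0) \<in> multi_indices 0"
  by (simp add: multi_indices_def)

lemma single_multi_indices: "(\<lambda>j. if j = i then 1 else 0) \<in> multi_indices 1"
  by (simp add: multi_indices_def)

lemma prod_single_multi_index:
  fixes f :: "'n::finite \<Rightarrow> complex"
  shows "(\<Prod>j\<in>UNIV. f j ^ (if j = i then 1 else 0)) = f i"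
  by (simp add: if_distrib[of "\<lambda>e. _ ^ e"] cong: if_cong)

definition real_monomial :: "('n::finite \<Rightarrow> nat) \<Rightarrow> real ^ 'n \<Rightarrow> complex" where
  "real_monomial \<alpha> x = (\<Prod>i\<in>UNIV. of_real (x $ i) ^ \<alpha> i)"

definition complex_monomial :: "('d::finite \<Rightarrow> nat) \<times> ('d \<Rightarrow> nat) \<Rightarrow> complex ^ 'd \<Rightarrow> complex" where
  "complex_monomial = (\<lambda>(\<alpha>, \<beta>) z. (\<Prod>j\<in>UNIV. (z $ j) ^ \<alpha> j) * (\<Prod>j\<in>UNIV. cnj (z $ j) ^ \<beta> j))"

lemma homogeneous_polys_eq: "homogeneous_polys k = fin_span (multi_indices k) real_monomial"
  by (simp add: homogeneous_polys_def fin_span_def real_monomial_def)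

lemma bihomogeneous_polys_eq:
  "(bihomogeneous_polys m n :: (complex ^ 'd \<Rightarrow> complex) set) =
    fin_span (multi_indices m \<times> multi_indices n) complex_monomial"
proof -
  have eq: "(\<lambda>z :: complex ^ 'd. \<Sum>\<alpha>\<in>multi_indices m. \<Sum>\<beta>\<in>multi_indices n.
        c \<alpha> \<beta> * (\<Prod>j\<in>UNIV. (z $ j) ^ \<alpha> j) * (\<Prod>j\<in>UNIV. cnj (z $ j) ^ \<beta> j)) =
      (\<lambda>z. \<Sum>a\<in>multi_indices m \<times> multi_indices n. case_prod c a * complex_monomial a z)" for c
    by (simp add: sum.cartesian_product complex_monomial_def case_prod_unfold mult.assoc)
  have "\<exists>c'. f = (\<lambda>z. \<Sum>a\<in>multi_indices m \<times> multi_indices n. case_prod c' a * complex_monomial a z)"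
    if "f = (\<lambda>z. \<Sum>a\<in>multi_indices m \<times> multi_indices n. c a * complex_monomial a z)"
    for f :: "complex ^ 'd \<Rightarrow> complex" and c
    using that by (intro exI[of _ "curry c"]) simp
  then show ?thesis
    unfolding bihomogeneous_polys_def fin_span_def eq by blast
qed

lemma homogeneous_polys_graded:
  "graded_functions (homogeneous_polys :: nat \<Rightarrow> (real ^ 'n \<Rightarrow> complex) set)"
proof
  have "real_monomial (\<lambda>_. 0) \<in> (homogeneous_polys 0 :: (real ^ 'n \<Rightarrow> complex) set)"
    unfolding homogeneous_polys_eq by (intro fin_span_base finite_multi_indices zero_multi_indices)
  then show "(\<lambda>_. 1) \<in> (homogeneous_polys 0 :: (real ^ 'n \<Rightarrow> complex) set)"
    by (simp add: real_monomial_def[abs_def])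
next
  fix f g :: "real ^ 'n \<Rightarrow> complex" and k l
  assume "f \<in> homogeneous_polys k" "g \<in> homogeneous_polys l"
  then show "(\<lambda>x. f x * g x) \<in> homogeneous_polys (k + l)"
    unfolding homogeneous_polys_eq
  proof (rule fin_span_mult[OF lin_closed_fin_span, rotated -2])
    fix \<alpha> \<beta> :: "'n \<Rightarrow> nat" assume "\<alpha> \<in> multi_indices k" "\<beta> \<in> multi_indices l"
    then have "real_monomial (\<lambda>i. \<alpha> i + \<beta> i) \<in> fin_span (multi_indices (k + l)) real_monomial"
      by (intro fin_span_base finite_multi_indices multi_indices_add)
    then show "(\<lambda>x. real_monomial \<alpha> x * real_monomial \<beta> x) \<in> fin_span (multi_indices (k + l)) real_monomial"
      by (simp add: real_monomial_def[abs_def] power_add prod.distrib)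
  qed
qed

lemma coordinate_homogeneous: "(\<lambda>x. of_real (x $ i)) \<in> homogeneous_polys 1"
proof -
  have "real_monomial (\<lambda>j. if j = i then 1 else 0) \<in> homogeneous_polys 1"
    unfolding homogeneous_polys_eq by (intro fin_span_base finite_multi_indices single_multi_indices)
  then show ?thesis
    unfolding real_monomial_def[abs_def] prod_single_multi_index .
qed

lemma bihomogeneous_polys_mult:
  assumes "f \<in> bihomogeneous_polys m n" "g \<in> bihomogeneous_polys m' n'"
  shows "(\<lambda>z. f z * g z) \<in> bihomogeneous_polys (m + m') (n + n')"
  using assms unfolding bihomogeneous_polys_eq
proof (rule fin_span_mult[OF lin_closed_fin_span, rotated -2])
  fix a b :: "('a \<Rightarrow> nat) \<times> ('a \<Rightarrow> nat)"
  assume "a \<in> multi_indices m \<times> multi_indices n" "b \<in> multi_indices m' \<times> multi_indices n'"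
  then have "complex_monomial (\<lambda>i. fst a i + fst b i, \<lambda>i. snd a i + snd b i) \<in>
      fin_span (multi_indices (m + m') \<times> multi_indices (n + n')) complex_monomial"
    by (intro fin_span_base) (auto simp: finite_multi_indices multi_indices_add)
  then show "(\<lambda>z. complex_monomial a z * complex_monomial b z) \<in>
      fin_span (multi_indices (m + m') \<times> multi_indices (n + n')) complex_monomial"
    by (simp add: complex_monomial_def power_add prod.distrib case_prod_unfold mult_ac)
qed

lemma one_bihomogeneous: "(\<lambda>_. 1) \<in> bihomogeneous_polys 0 0"
proof -
  have "complex_monomial (\<lambda>_. 0, \<lambda>_. 0) \<in> bihomogeneous_polys 0 0"
    unfolding bihomogeneous_polys_eq
    by (intro fin_span_base) (auto simp: finite_multi_indices zero_multi_indices)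
  then show ?thesis by (simp add: complex_monomial_def)
qed

lemma coordinate_bihomogeneous:
  "(\<lambda>z. z $ j) \<in> bihomogeneous_polys 1 0" "(\<lambda>z. cnj (z $ j)) \<in> bihomogeneous_polys 0 1"
proof -
  let ?e = "\<lambda>i. if i = j then 1 else 0 :: nat"
  have "complex_monomial (?e, \<lambda>_. 0) \<in> bihomogeneous_polys 1 0"
    "complex_monomial (\<lambda>_. 0, ?e) \<in> bihomogeneous_polys 0 1"
    unfolding bihomogeneous_polys_eq
    by (intro fin_span_base; simp add: finite_multi_indices zero_multi_indices single_multi_indices[simplified])+
  moreover have "complex_monomial (?e, \<lambda>_. 0) = (\<lambda>z. z $ j)"
    "complex_monomial (\<lambda>_. 0, ?e) = (\<lambda>z. cnj (z $ j))"
    unfolding complex_monomial_def prod.case prod_single_multi_index by simp_all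
  ultimately show "(\<lambda>z. z $ j) \<in> bihomogeneous_polys 1 0" "(\<lambda>z. cnj (z $ j)) \<in> bihomogeneous_polys 0 1"
    by simp_all
qed

lemma cnj_bihomogeneous:
  assumes "f \<in> bihomogeneous_polys m n"
  shows "(\<lambda>z. cnj (f z)) \<in> bihomogeneous_polys n m"
proof -
  obtain c where f: "f = (\<lambda>z. \<Sum>a\<in>multi_indices m \<times> multi_indices n. c a * complex_monomial a z)"
    using assms by (auto simp: bihomogeneous_polys_eq fin_span_def)
  have "(\<lambda>z. cnj (f z)) = (\<lambda>z. \<Sum>a\<in>multi_indices m \<times> multi_indices n. cnj (c a) * complex_monomial (prod.swap a) z)"
    by (simp add: f complex_monomial_def case_prod_unfold mult_ac)
  also have "\<dots> \<in> bihomogeneous_polys n m"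
    unfolding bihomogeneous_polys_eq
    by (intro lin_closed_sum lin_closed_scale lin_closed_fin_span fin_span_base)
      (auto simp: finite_multi_indices)
  finally show ?thesis .
qed

text \<open>
  The circle acts on bidegree \<open>(m, n)\<close> by the character \<open>w \<mapsto> w\<^sup>m\<close> times the conjugate of \<open>w\<close> to the \<open>n\<close>,
  which is how the components of a sum are told apart.
\<close>

lemma bihomogeneous_rotate:
  assumes "f \<in> bihomogeneous_polys m n"
  shows "f (w *s z) = w ^ m * cnj w ^ n * f z"
proof -
  have "complex_monomial a (w *s z) = w ^ m * cnj w ^ n * complex_monomial a z"
    if "a \<in> multi_indices m \<times> multi_indices n" for a
    using that by (auto simp: complex_monomial_def multi_indices_def power_mult_distrib prod.distrib
        power_sum mult_ac)
  then show ?thesis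
    using assms by (auto simp: bihomogeneous_polys_eq fin_span_def sum_distrib_left mult.left_commute intro!: sum.cong)
qed

definition bihomogeneous_sums :: "nat \<Rightarrow> (complex ^ 'd \<Rightarrow> complex) set" where
  "bihomogeneous_sums k = {f. \<exists>g. (\<forall>n\<le>k. g n \<in> bihomogeneous_polys (k - n) n) \<and> f = (\<lambda>z. \<Sum>n\<le>k. g n z)}"

lemma lin_closed_bihomogeneous_polys: "lin_closed (bihomogeneous_polys m n)"
  by (simp add: bihomogeneous_polys_eq lin_closed_fin_span)

lemma lin_closed_homogeneous_polys: "lin_closed (homogeneous_polys k)"
  by (simp add: homogeneous_polys_eq lin_closed_fin_span)

lemma lin_closed_bihomogeneous_sums: "lin_closed (bihomogeneous_sums k)"
  unfolding lin_closed_def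
proof (intro conjI ballI allI)
  show "(\<lambda>_. 0) \<in> bihomogeneous_sums k"
    by (auto simp: bihomogeneous_sums_def lin_closed_zero lin_closed_bihomogeneous_polys intro!: exI[of _ "\<lambda>_ _. 0"])
next
  fix f g :: "complex ^ 'd \<Rightarrow> complex" assume "f \<in> bihomogeneous_sums k" "g \<in> bihomogeneous_sums k"
  then obtain f' g' where "\<forall>n\<le>k. f' n \<in> bihomogeneous_polys (k - n) n" "\<forall>n\<le>k. g' n \<in> bihomogeneous_polys (k - n) n"
    "f = (\<lambda>z. \<Sum>n\<le>k. f' n z)" "g = (\<lambda>z. \<Sum>n\<le>k. g' n z)"
    by (auto simp: bihomogeneous_sums_def)
  then show "(\<lambda>x. f x + g x) \<in> bihomogeneous_sums k"
    by (auto simp: bihomogeneous_sums_def sum.distrib intro!: exI[of _ "\<lambda>n z. f' n z + g' n z"]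
        lin_closed_add lin_closed_bihomogeneous_polys)
next
  fix c and f :: "complex ^ 'd \<Rightarrow> complex" assume "f \<in> bihomogeneous_sums k"
  then obtain f' where "\<forall>n\<le>k. f' n \<in> bihomogeneous_polys (k - n) n" "f = (\<lambda>z. \<Sum>n\<le>k. f' n z)"
    by (auto simp: bihomogeneous_sums_def)
  then show "(\<lambda>x. c * f x) \<in> bihomogeneous_sums k"
    by (auto simp: bihomogeneous_sums_def sum_distrib_left intro!: exI[of _ "\<lambda>n z. c * f' n z"]
        lin_closed_scale lin_closed_bihomogeneous_polys)
qed

lemma bihomogeneous_in_sums:
  assumes "f \<in> bihomogeneous_polys m n"
  shows "f \<in> bihomogeneous_sums (m + n)"
  unfolding bihomogeneous_sums_def
proof (intro CollectI exI conjI allI impI)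
  let ?g = "\<lambda>i z. if i = n then f z else 0"
  show "f = (\<lambda>z. \<Sum>i\<le>m + n. ?g i z)" by (simp add: fun_eq_iff)
  show "?g i \<in> bihomogeneous_polys (m + n - i) i" for i
    using assms by (cases "i = n") (auto simp: lin_closed_zero lin_closed_bihomogeneous_polys)
qed

lemma bihomogeneous_sums_graded: "graded_functions bihomogeneous_sums"
proof
  show "(\<lambda>_. 1) \<in> bihomogeneous_sums 0"
    using bihomogeneous_in_sums[OF one_bihomogeneous] by simp
next
  fix f g :: "complex ^ 'd \<Rightarrow> complex" and k l
  assume "f \<in> bihomogeneous_sums k" "g \<in> bihomogeneous_sums l"
  then obtain f' g' where fg: "\<And>n. n \<le> k \<Longrightarrow> f' n \<in> bihomogeneous_polys (k - n) n"
    "\<And>n. n \<le> l \<Longrightarrow> g' n \<in> bihomogeneous_polys (l - n) n"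
    "f = (\<lambda>z. \<Sum>n\<le>k. f' n z)" "g = (\<lambda>z. \<Sum>n\<le>l. g' n z)"
    by (auto simp: bihomogeneous_sums_def)
  have "(\<lambda>z. f' i z * g' j z) \<in> bihomogeneous_sums (k + l)" if "i \<le> k" "j \<le> l" for i j
  proof -
    have "k - i + (l - j) + (i + j) = k + l" using that by simp
    then show ?thesis
      using bihomogeneous_in_sums[OF bihomogeneous_polys_mult[OF fg(1)[OF that(1)] fg(2)[OF that(2)]]]
      by simp
  qed
  then have "(\<lambda>z. \<Sum>i\<le>k. \<Sum>j\<le>l. f' i z * g' j z) \<in> bihomogeneous_sums (k + l)"
    by (intro lin_closed_sum lin_closed_bihomogeneous_sums) auto
  then show "(\<lambda>z. f z * g z) \<in> bihomogeneous_sums (k + l)"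
    by (simp add: fg(3,4) sum_product)
qed

text \<open>
  It suffices to treat the coordinates, and \<open>x = (z + cnj z) / 2\<close>, \<open>y = (z - cnj z) / (2 \<i>)\<close>.
\<close>

lemma homogeneous_comp_Upsilon:
  fixes f :: "real ^ ('d::finite \<times> 2) \<Rightarrow> complex"
  assumes "f \<in> homogeneous_polys k"
  shows "(\<lambda>z. f (Upsilon z)) \<in> bihomogeneous_sums k"
proof -
  interpret graded_functions "bihomogeneous_sums :: nat \<Rightarrow> (complex ^ 'd \<Rightarrow> complex) set"
    by (rule bihomogeneous_sums_graded)
  have coord: "(\<lambda>z :: complex ^ 'd. of_real (Upsilon z $ ki)) \<in> bihomogeneous_sums 1" for ki
  proof -
    have zz: "(\<lambda>z :: complex ^ 'd. z $ j) \<in> bihomogeneous_sums 1"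
      "(\<lambda>z :: complex ^ 'd. cnj (z $ j)) \<in> bihomogeneous_sums 1" for j
      using coordinate_bihomogeneous[of j, THEN bihomogeneous_in_sums] by simp_all
    have "(\<lambda>z :: complex ^ 'd. of_real (Upsilon z $ ki)) =
        (if snd ki = 1 then (\<lambda>z. (1 / 2) * (z $ fst ki) + (1 / 2) * cnj (z $ fst ki))
         else (\<lambda>z. (- \<i> / 2) * (z $ fst ki) + (\<i> / 2) * cnj (z $ fst ki)))"
      by (auto simp: Upsilon_def fun_eq_iff complex_eq_iff)
    also have "\<dots> \<in> bihomogeneous_sums 1"
      using zz by (simp only: split: if_split)
        (intro conjI impI lin_closed_add lin_closed_scale lin_closed_bihomogeneous_sums)
    finally show ?thesis .
  qed
  obtain c where f: "f = (\<lambda>x. \<Sum>\<alpha>\<in>multi_indices k. c \<alpha> * real_monomial \<alpha> x)"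
    using assms by (auto simp: homogeneous_polys_eq fin_span_def)
  have "(\<lambda>z. real_monomial \<alpha> (Upsilon z)) \<in> bihomogeneous_sums k"
    if "\<alpha> \<in> multi_indices k" for \<alpha> :: "'d \<times> 2 \<Rightarrow> nat"
    using monomial[OF finite[of UNIV] coord, where \<alpha> = \<alpha>] that by (simp add: real_monomial_def multi_indices_def)
  then show ?thesis
    unfolding f by (intro lin_closed_sum lin_closed_scale lin_closed_bihomogeneous_sums) auto
qed

lemma inv_Upsilon_component:
  "inv Upsilon x $ j = of_real (x $ (j, 1)) + \<i> * of_real (x $ (j, 2))"
proof -
  obtain z where x: "x = Upsilon z"
    using Upsilon_image_eq_vimage[of UNIV] by auto
  then have "inv Upsilon x = z"
    by (simp add: inj_Upsilon)
  then show ?thesis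
    by (simp add: x Upsilon_def complex_eq_iff)
qed

lemma bihomogeneous_comp_inv_Upsilon:
  fixes f :: "complex ^ 'd \<Rightarrow> complex"
  assumes "f \<in> bihomogeneous_polys m n"
  shows "(\<lambda>x. f (inv Upsilon x)) \<in> homogeneous_polys (m + n)"
proof -
  interpret graded_functions "homogeneous_polys :: nat \<Rightarrow> (real ^ ('d \<times> 2) \<Rightarrow> complex) set"
    by (rule homogeneous_polys_graded)
  have lin: "(\<lambda>x. of_real (x $ (j, 1)) + c * of_real (x $ (j, 2))) \<in>
      (homogeneous_polys 1 :: (real ^ ('d \<times> 2) \<Rightarrow> complex) set)" for j c
    by (intro lin_closed_add lin_closed_scale lin_closed_homogeneous_polys coordinate_homogeneous)
  have coord: "(\<lambda>x :: real ^ ('d \<times> 2). inv Upsilon x $ j) \<in> homogeneous_polys 1"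
     "(\<lambda>x :: real ^ ('d \<times> 2). cnj (inv Upsilon x $ j)) \<in> homogeneous_polys 1" for j
    using lin[of j \<i>] lin[of j "- \<i>"] by (simp_all add: inv_Upsilon_component)
  obtain c where f: "f = (\<lambda>z. \<Sum>a\<in>multi_indices m \<times> multi_indices n. c a * complex_monomial a z)"
    using assms by (auto simp: bihomogeneous_polys_eq fin_span_def)
  have "(\<lambda>x. complex_monomial a (inv Upsilon x)) \<in> homogeneous_polys (m + n)"
    if "a \<in> multi_indices m \<times> multi_indices n" for a :: "('d \<Rightarrow> nat) \<times> ('d \<Rightarrow> nat)"
    using mult[OF monomial[OF finite[of UNIV] coord(1), where \<alpha> = "fst a"] monomial[OF finite[of UNIV] coord(2), where \<alpha> = "snd a"]] that
    by (auto simp: complex_monomial_def multi_indices_def)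
  then show ?thesis
    unfolding f by (intro lin_closed_sum lin_closed_scale lin_closed_homogeneous_polys) auto
qed

lemma homogeneous_polyfun:
  fixes f :: "real ^ 'n \<Rightarrow> complex"
  assumes "f \<in> homogeneous_polys k" shows "f \<in> polyfun"
proof -
  have "(\<lambda>x :: real ^ 'n. complex_of_real (x $ i)) \<in> polyfun" for i :: 'n
    by (rule polyfun.linear) (rule bounded_linear_compose[OF bounded_linear_of_real bounded_linear_vec_nth])
  then have "real_monomial \<alpha> \<in> polyfun" for \<alpha> :: "'n \<Rightarrow> nat"
    unfolding real_monomial_def[abs_def] by (intro polyfun_prod polyfun_power)
  with assms show ?thesis
    by (auto simp: homogeneous_polys_eq fin_span_def intro!: polyfun_sum polyfun_cmult)
qed

lemma bihomogeneous_polyfun: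
  fixes f :: "complex ^ 'd \<Rightarrow> complex"
  assumes "f \<in> bihomogeneous_polys m n" shows "f \<in> polyfun"
proof -
  have "(\<lambda>z :: complex ^ 'd. z $ j) \<in> polyfun" for j :: 'd
    by (rule polyfun.linear) (rule bounded_linear_vec_nth)
  then have "complex_monomial a \<in> polyfun" for a :: "('d \<Rightarrow> nat) \<times> ('d \<Rightarrow> nat)"
    unfolding complex_monomial_def case_prod_unfold
    by (intro polyfun.mult polyfun_prod polyfun_power polyfun_cnj)
  with assms show ?thesis
    by (auto simp: bihomogeneous_polys_eq fin_span_def intro!: polyfun_sum polyfun_cmult)
qed

text \<open>
  Applying the Laplacian to \<open>f (w z) = \<Sum> w\<^sup>k\<^sup>-\<^sup>n (cnj w)\<^sup>n g\<^sub>n z\<close> and multiplying by \<open>w\<^sup>k\<close> gives a polynomial in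
  \<open>u = w\<^sup>2\<close> whose coefficients are the values \<open>\<Delta> g\<^sub>n z\<close>. It vanishes on the unit circle, which is infinite, so
  all of its coefficients vanish.
\<close>

lemma harmonic_bihomogeneous_components:
  fixes f :: "complex ^ 'd \<Rightarrow> complex"
  assumes g: "\<And>n. n \<le> k \<Longrightarrow> g n \<in> bihomogeneous_polys (k - n) n"
    and f: "f = (\<lambda>z. \<Sum>n\<le>k. g n z)" and harm: "\<And>z. complex_laplacian f z = 0"
    and n: "n \<le> k"
  shows "complex_laplacian (g n) z = 0"
proof -
  have gp: "g n \<in> polyfun" if "n \<le> k" for n
    using g[OF that] by (rule bihomogeneous_polyfun)
  then have fp: "f \<in> polyfun"
    unfolding f by (intro polyfun_sum) auto
  define c where "c i = complex_laplacian (g (k - i)) z" for i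
  have "(\<Sum>i\<le>k. c i * u ^ i) = 0" if u: "cmod u = 1" for u
  proof -
    define w where "w = csqrt u"
    have w: "cmod w = 1" "w ^ 2 = u"
      using u by (simp_all add: w_def)
    then have ww: "w * cnj w = 1"
      by (simp add: complex_norm_square[symmetric])
    have "0 = complex_laplacian (\<lambda>z. f (w *s z)) z"
      using complex_laplacian_rotate[OF fp w(1)] harm by simp
    also have "(\<lambda>z. f (w *s z)) = (\<lambda>z. \<Sum>n\<le>k. (w ^ (k - n) * cnj w ^ n) * g n z)"
      unfolding f by (intro ext sum.cong refl bihomogeneous_rotate) (auto intro: g)
    also have "complex_laplacian \<dots> z = (\<Sum>n\<le>k. (w ^ (k - n) * cnj w ^ n) * complex_laplacian (g n) z)"
      by (rule complex_laplacian_sum_cmult) (auto intro: gp)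
    finally have "0 = w ^ k * \<dots>" by simp
    also have "\<dots> = (\<Sum>n\<le>k. complex_laplacian (g n) z * u ^ (k - n))"
      unfolding sum_distrib_left
    proof (intro sum.cong refl)
      fix n assume "n \<in> {..k}"
      then have "w ^ k = w ^ n * w ^ (k - n)" by (simp flip: power_add)
      then have "w ^ k * (w ^ (k - n) * cnj w ^ n) = (w * cnj w) ^ n * (w ^ 2) ^ (k - n)"
        by (simp add: power_mult_distrib power2_eq_square)
      then show "w ^ k * (w ^ (k - n) * cnj w ^ n * complex_laplacian (g n) z) = complex_laplacian (g n) z * u ^ (k - n)"
        by (simp add: ww w(2) flip: mult.assoc)
    qed
    also have "\<dots> = (\<Sum>i\<le>k. c i * u ^ i)"
      unfolding c_def by (rule sum.reindex_bij_witness[of _ "\<lambda>i. k - i" "\<lambda>i. k - i"]) auto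
    finally show ?thesis by simp
  qed
  then have "sphere 0 1 \<subseteq> {u. (\<Sum>i\<le>k. c i * u ^ i) = 0}" by auto
  moreover have "infinite (sphere (0 :: complex) 1)"
  proof
    assume "finite (sphere (0 :: complex) 1)"
    moreover have "connected (sphere (0 :: complex) 1)"
      by (rule connected_sphere) simp
    ultimately have "sphere (0 :: complex) 1 = {} \<or> (\<exists>a. sphere (0 :: complex) 1 = {a})"
      using connected_finite_iff_sing by blast
    moreover have "1 \<in> sphere (0 :: complex) 1" "-1 \<in> sphere (0 :: complex) 1" by simp_all
    ultimately have "(1 :: complex) = -1" by (metis emptyE singletonD)
    then show False by simp
  qed
  ultimately have "infinite {u. (\<Sum>i\<le>k. c i * u ^ i) = 0}"
    using finite_subset by blast
  then have "c (k - n) = 0"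
    using polyfun_finite_roots[of c k] by auto
  with n show ?thesis by (simp add: c_def)
qed

section \<open>Harmonics on the two spheres\<close>

lemma polyfun_surface_measurable:
  fixes F :: "'e::euclidean_space \<Rightarrow> complex"
  assumes "F \<in> polyfun" shows "F \<in> borel_measurable surface_measure"
proof -
  have "F \<in> borel_measurable borel"
    by (rule borel_measurable_continuous_onI) (rule polyfun_continuous[OF assms])
  then have "F \<in> borel_measurable (restrict_space borel (sphere 0 1))"
    by (rule measurable_restrict_space1)
  then show ?thesis
    by (simp add: measurable_cong_sets[OF sets_surface_measure refl])
qed

lemma polyfun_surface_bounded:
  fixes F :: "'e::euclidean_space \<Rightarrow> complex"
  assumes "F \<in> polyfun" shows "\<exists>C. \<forall>x\<in>sphere 0 1. cmod (F x) \<le> C"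
proof -
  have "compact (F ` sphere 0 1)"
    by (intro compact_continuous_image polyfun_continuous assms compact_sphere)
  then have "bounded (F ` sphere 0 1)"
    by (rule compact_imp_bounded)
  then show ?thesis
    by (auto simp: bounded_iff)
qed

text \<open>
  A continuous function that is nonzero at a point of the sphere is nonzero on a relatively open set, which
  has positive measure.
\<close>

lemma polyfun_surface_definite:
  fixes F :: "'e::euclidean_space \<Rightarrow> complex"
  assumes F: "F \<in> polyfun" and ae: "AE x in surface_measure. F x = 0" and x: "norm x = 1"
  shows "F x = 0"
proof (rule ccontr)
  assume "F x \<noteq> 0"
  have [measurable]: "F \<in> borel_measurable surface_measure"
    using F by (rule polyfun_surface_measurable)
  have "{x \<in> space surface_measure. F x \<noteq> 0} \<in> sets surface_measure" by measurable
  then have "{x \<in> space surface_measure. F x \<noteq> 0} \<in> null_sets surface_measure"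
    using ae by (simp add: AE_iff_null_sets[symmetric] AE_iff_null)
  moreover have "{x \<in> space surface_measure. F x \<noteq> 0} = sphere 0 1 \<inter> {x. F x \<noteq> 0}"
    by auto
  moreover have "open {x. F x \<noteq> 0}"
    by (intro open_Collect_neq polyfun_continuous[OF F] continuous_on_const)
  ultimately show False
    using null_set_surface_relatively_open[of "{x. F x \<noteq> 0}" x] x \<open>F x \<noteq> 0\<close> by simp
qed

lemma kernel_space_surface:
  fixes P :: "('e::euclidean_space \<Rightarrow> complex) set"
  assumes "lin_closed P" "P \<subseteq> polyfun"
  shows "kernel_space surface_measure P"
proof -
  interpret finite_measure "surface_measure :: 'e measure"
    by (rule finite_measure_surface)
  show ?thesis
    by standard (use assms in \<open>auto intro: polyfun_surface_measurable polyfun_surface_bounded polyfun_surface_definite\<close>)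
qed

text \<open>
  The harmonic polynomials on the whole space, before restriction to the sphere.
\<close>

definition solid_harmonics :: "nat \<Rightarrow> (real ^ 'n \<Rightarrow> complex) set" where
  "solid_harmonics k = {f \<in> homogeneous_polys k. \<forall>x. laplacian f x = 0}"

definition solid_biharmonics :: "nat \<Rightarrow> nat \<Rightarrow> (complex ^ 'd \<Rightarrow> complex) set" where
  "solid_biharmonics m n = {f \<in> bihomogeneous_polys m n. \<forall>z. complex_laplacian f z = 0}"

lemma sphere_harmonics_eq: "sphere_harmonics k = (\<lambda>f. restrict f (space surface_measure)) ` solid_harmonics k"
  by (auto simp: sphere_harmonics_def solid_harmonics_def)

lemma Omega_harmonics_eq: "Omega_harmonics m n = (\<lambda>f. restrict f (space sigma_Omega)) ` solid_biharmonics m n"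
  by (auto simp: Omega_harmonics_def solid_biharmonics_def)

text \<open>
  The null space of an operator that is linear on a larger space \<open>Q\<close>. Linearity is
  assumed for sums over index sets of type \<open>bool set\<close>, which cover the three cases of zero, sum and multiple.
\<close>

lemma lin_closed_kernel:
  assumes P: "lin_closed P" "P \<subseteq> Q"
    and L: "\<And>(I :: bool set) c f x. (\<And>i. i \<in> I \<Longrightarrow> f i \<in> Q) \<Longrightarrow> L (\<lambda>x. \<Sum>i\<in>I. c i * f i x) x = (\<Sum>i\<in>I. c i * L (f i) x)"
  shows "lin_closed {f \<in> P. \<forall>x. L f x = (0 :: complex)}"
  unfolding lin_closed_def
proof (intro conjI ballI allI CollectI; (elim CollectE conjE)?)
  show "(\<lambda>_. 0) \<in> P" using P by (simp add: lin_closed_zero)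
  show "L (\<lambda>_. 0) x = 0" for x using L[of "{}"] by simp
next
  fix f g x assume fg: "f \<in> P" "g \<in> P" "\<forall>x. L f x = 0" "\<forall>x. L g x = 0"
  then have "(if b then f else g) \<in> Q" for b
    using P(2) by auto
  from L[of "{True, False}" "\<lambda>b. if b then f else g" "\<lambda>_. 1" x, OF this] fg
  show "L (\<lambda>x. f x + g x) x = 0" by simp
  show "(\<lambda>x. f x + g x) \<in> P"
    using P(1) fg(1,2) by (rule lin_closed_add)
next
  fix c f x assume "f \<in> P" "\<forall>x. L f x = 0"
  then show "(\<lambda>x. c * f x) \<in> P" "L (\<lambda>x. c * f x) x = 0"
    using P L[of "{True}" "\<lambda>b. f" "\<lambda>_. c" x]
    by (auto intro: lin_closed_scale)
qed

lemma solid_harmonics_lin_closed: "lin_closed (solid_harmonics k)"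
  unfolding solid_harmonics_def
  by (rule lin_closed_kernel[OF lin_closed_homogeneous_polys _ laplacian_sum_cmult])
    (auto intro: homogeneous_polyfun)

lemma solid_biharmonics_lin_closed: "lin_closed (solid_biharmonics m n)"
  unfolding solid_biharmonics_def
  by (rule lin_closed_kernel[OF lin_closed_bihomogeneous_polys _ complex_laplacian_sum_cmult])
    (auto intro: bihomogeneous_polyfun)

lemma solid_harmonics_comp_Upsilon:
  fixes f :: "real ^ ('d::finite \<times> 2) \<Rightarrow> complex"
  assumes f: "f \<in> solid_harmonics k"
  shows "\<exists>g. (\<forall>n\<le>k. g n \<in> solid_biharmonics (k - n) n) \<and> (\<forall>z. f (Upsilon z) = (\<Sum>n\<le>k. g n z))"
proof -
  have "(\<lambda>z :: complex ^ 'd. f (Upsilon z)) \<in> bihomogeneous_sums k"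
    using f by (intro homogeneous_comp_Upsilon) (simp add: solid_harmonics_def)
  then obtain g where g: "\<And>n. n \<le> k \<Longrightarrow> g n \<in> bihomogeneous_polys (k - n) n"
    "(\<lambda>z :: complex ^ 'd. f (Upsilon z)) = (\<lambda>z. \<Sum>n\<le>k. g n z)"
    by (auto simp: bihomogeneous_sums_def)
  have "complex_laplacian (\<lambda>z :: complex ^ 'd. f (Upsilon z)) z = 0" for z
    using f complex_laplacian_Upsilon[OF homogeneous_polyfun[of f k], of z]
    by (simp add: solid_harmonics_def)
  then have "complex_laplacian (g n) z = 0" if "n \<le> k" for n z
    using harmonic_bihomogeneous_components[of k g, OF g] that by blast
  then have "\<forall>n\<le>k. g n \<in> solid_biharmonics (k - n) n"
    using g(1) by (simp add: solid_biharmonics_def)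
  moreover have "\<forall>z. f (Upsilon z) = (\<Sum>n\<le>k. g n z)"
    using g(2) by (simp add: fun_eq_iff)
  ultimately show ?thesis by blast
qed

lemma solid_biharmonics_comp_inv_Upsilon:
  fixes f :: "complex ^ 'd \<Rightarrow> complex"
  assumes f: "f \<in> solid_biharmonics m n"
  shows "f \<circ> inv Upsilon \<in> solid_harmonics (m + n)"
proof -
  have hom: "f \<circ> inv Upsilon \<in> homogeneous_polys (m + n)"
    using bihomogeneous_comp_inv_Upsilon[of f m n] f by (simp add: solid_biharmonics_def comp_def)
  have "laplacian (f \<circ> inv Upsilon) x = 0" for x
  proof -
    obtain z where "x = Upsilon z"
      using Upsilon_image_eq_vimage[of "UNIV :: (complex ^ 'd) set"] by auto
    then show ?thesis
      using complex_laplacian_Upsilon[OF homogeneous_polyfun[OF hom], of z] f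
      by (simp add: solid_biharmonics_def inj_Upsilon)
  qed
  with hom show ?thesis by (simp add: solid_harmonics_def)
qed

lemma cnj_solid_biharmonics:
  assumes "f \<in> solid_biharmonics m n"
  shows "(\<lambda>z. cnj (f z)) \<in> solid_biharmonics n m"
  using assms bihomogeneous_polyfun[of f m n]
  by (simp add: solid_biharmonics_def cnj_bihomogeneous complex_laplacian_cnj)

lemma kernel_space_solid_harmonics: "kernel_space surface_measure (solid_harmonics k)"
  by (rule kernel_space_surface[OF solid_harmonics_lin_closed])
    (auto simp: solid_harmonics_def homogeneous_polyfun)

lemma kernel_space_solid_biharmonics:
  "kernel_space (sigma_Omega :: (complex ^ 'd) measure) (solid_biharmonics m n)"
proof -
  interpret measure_iso "sigma_Omega :: (complex ^ 'd) measure" surface_measure Upsilon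
    by (rule measure_iso_Upsilon)
  show ?thesis
  proof (rule kernel_space_pullback[OF kernel_space_solid_harmonics solid_biharmonics_lin_closed])
    fix f :: "complex ^ 'd \<Rightarrow> complex" assume "f \<in> solid_biharmonics m n"
    then have "f \<circ> inv Upsilon \<in> solid_harmonics (m + n)"
      by (rule solid_biharmonics_comp_inv_Upsilon)
    moreover have "f = (f \<circ> inv Upsilon) \<circ> Upsilon"
      by (simp add: fun_eq_iff inj_Upsilon)
    ultimately show "\<exists>F\<in>solid_harmonics (m + n). f = F \<circ> Upsilon" by blast
  qed
qed

section \<open>Multipliers and widths on the two spheres\<close>

text \<open>
  The convolution on the real sphere uses the kernel without a conjugate. Conjugating the
  whole equation brings it into the form of \<open>multiplier_iff_orthogonal\<close>, and the conjugates cancel in the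
  orthogonality condition.
\<close>

lemma sphere_conv_iff:
  fixes g h :: "real ^ 'n \<Rightarrow> complex"
  assumes g: "integrable surface_measure g" and h: "integrable surface_measure h"
  shows "(\<forall>x\<in>space surface_measure. sphere_conv k g x = l * sphere_conv k h x) \<longleftrightarrow>
    (\<forall>f\<in>solid_harmonics k. (LINT x|surface_measure. (g x - l * h x) * f x) = 0)"
proof -
  interpret kernel_space surface_measure "solid_harmonics k :: (real ^ 'n \<Rightarrow> complex) set"
    by (rule kernel_space_solid_harmonics)
  obtain b and n where "\<forall>f\<in>homogeneous_polys k. \<exists>c. f = (\<lambda>x :: real ^ 'n. \<Sum>i<n::nat. c i * b i x)"
    using fin_span_enum[OF finite_multi_indices] unfolding homogeneous_polys_eq by blast
  then have fin: "\<exists>c. f = (\<lambda>x :: real ^ 'n. \<Sum>i<n::nat. c i * b i x)" if "f \<in> solid_harmonics k" for f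
    using that by (simp add: solid_harmonics_def)
  let ?Z = "reproducing_kernel surface_measure (sphere_harmonics k :: (real ^ 'n \<Rightarrow> complex) set)"
  have conv: "sphere_conv k g x = cnj (LINT y|surface_measure. cnj (g y) * cnj (?Z x y))" for g x
  proof -
    have "sphere_conv k g x = (LINT y|surface_measure. cnj (cnj (g y) * cnj (?Z x y)))"
      by (simp add: sphere_conv_def)
    then show ?thesis by (simp only: Bochner_Integration.integral_cnj)
  qed
  have "(sphere_conv k g x = l * sphere_conv k h x) \<longleftrightarrow>
     (LINT y|surface_measure. cnj (g y) * cnj (?Z x y)) = cnj l * (LINT y|surface_measure. cnj (h y) * cnj (?Z x y))" for x
  proof -
    have "cnj A = l * cnj B \<longleftrightarrow> A = cnj l * B" for A B
      by (metis complex_cnj_cnj complex_cnj_mult)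
    then show ?thesis unfolding conv .
  qed
  moreover have "(\<forall>x\<in>space surface_measure. (LINT y|surface_measure. cnj (g y) * cnj (?Z x y)) =
        cnj l * (LINT y|surface_measure. cnj (h y) * cnj (?Z x y))) \<longleftrightarrow>
      (\<forall>f\<in>solid_harmonics k. (LINT x|surface_measure. (cnj (g x) - cnj l * cnj (h x)) * cnj (f x)) = 0)"
    unfolding sphere_harmonics_eq
    by (rule multiplier_iff_orthogonal[OF fin integrable_cnj[OF g] integrable_cnj[OF h]])
  moreover have "(LINT x|surface_measure. (cnj (g x) - cnj l * cnj (h x)) * cnj (f x)) =
      cnj (LINT x|surface_measure. (g x - l * h x) * f x)" for f :: "real ^ 'n \<Rightarrow> complex"
  proof -
    have "(LINT x|surface_measure. (cnj (g x) - cnj l * cnj (h x)) * cnj (f x)) =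
        (LINT x|surface_measure. cnj ((g x - l * h x) * f x))"
      by simp
    then show ?thesis by (simp only: Bochner_Integration.integral_cnj)
  qed
  ultimately show ?thesis by simp
qed

lemma Omega_conv_iff:
  fixes g h :: "complex ^ 'd \<Rightarrow> complex"
  assumes g: "integrable sigma_Omega g" and h: "integrable sigma_Omega h"
  shows "(\<forall>w\<in>space sigma_Omega. Omega_conv (m, n) g w = l * Omega_conv (m, n) h w) \<longleftrightarrow>
    (\<forall>f\<in>solid_biharmonics m n. (LINT z|sigma_Omega. (g z - l * h z) * cnj (f z)) = 0)"
proof -
  interpret kernel_space sigma_Omega "solid_biharmonics m n :: (complex ^ 'd \<Rightarrow> complex) set"
    by (rule kernel_space_solid_biharmonics)
  have "finite (multi_indices m \<times> multi_indices n :: (('d \<Rightarrow> nat) \<times> ('d \<Rightarrow> nat)) set)"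
    by (simp add: finite_multi_indices)
  then obtain b and N where "\<forall>f\<in>bihomogeneous_polys m n. \<exists>c. f = (\<lambda>z :: complex ^ 'd. \<Sum>i<N::nat. c i * b i z)"
    using fin_span_enum unfolding bihomogeneous_polys_eq by blast
  then have fin: "\<exists>c. f = (\<lambda>z :: complex ^ 'd. \<Sum>i<N::nat. c i * b i z)" if "f \<in> solid_biharmonics m n" for f
    using that by (simp add: solid_biharmonics_def)
  show ?thesis
    unfolding Omega_conv_def prod.case Omega_harmonics_eq
    by (rule multiplier_iff_orthogonal[OF fin g h])
qed

text \<open>
  Both sides become orthogonality conditions for the same function on the sphere, carried to \<open>\<Omega>\<close> by \<open>\<Upsilon>\<close>. On
  the real side the test functions are the harmonic polynomials of degree \<open>k\<close>, on the complex side the conjugates of the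
  harmonics of bidegree \<open>(m, n)\<close>, which are the harmonics of bidegree \<open>(n, m)\<close>. For
  \<open>m + n = k\<close> the latter span the former, and the factor \<open>lam k\<close> is common to them.
\<close>

lemma multiplier_pull_iff:
  fixes \<phi> f :: "(real ^ ('d::finite \<times> 2) \<Rightarrow> complex) set" and lam :: "nat \<Rightarrow> complex"
  assumes p: "1 \<le> p" "1 \<le> q"
    and \<phi>: "\<phi> \<in> vecs (Lp surface_measure p)" and f: "f \<in> vecs (Lp surface_measure q)"
  defines "pull \<equiv> measure_iso.pull (Upsilon :: complex ^ 'd \<Rightarrow> _)"
  shows "(\<forall>i. \<forall>w\<in>space sigma_Omega. Omega_conv i (rep (pull f)) w =
            (case i of (m, n) \<Rightarrow> lam (m + n)) * Omega_conv i (rep (pull \<phi>)) w) \<longleftrightarrow>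
         (\<forall>k. \<forall>x\<in>space surface_measure. sphere_conv k (rep f) x = lam k * sphere_conv k (rep \<phi>) x)"
proof -
  let ?S = "surface_measure :: (real ^ ('d \<times> 2)) measure" and ?O = "sigma_Omega :: (complex ^ 'd) measure"
  interpret U: measure_iso ?O ?S Upsilon by (rule measure_iso_Upsilon)
  interpret S: finite_measure ?S by (rule finite_measure_surface)
  interpret O: finite_measure ?O
    using kernel_space_solid_biharmonics[of 0 0] by (rule kernel_space.axioms)
  define a b where "a = rep \<phi>" and "b = rep f"
  define a' b' where "a' = rep (pull \<phi>)" and "b' = rep (pull f)"
  have integrable_rep: "integrable ?S a" "integrable ?S b" "integrable ?O a'" "integrable ?O b'"
    unfolding a_def b_def a'_def b'_def pull_def
    using p \<phi> f by (auto intro: S.Lp_fun_integrable O.Lp_fun_integrable rep_Lp_fun U.rep_pull(1))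
  then have [measurable]: "a \<in> borel_measurable ?S" "b \<in> borel_measurable ?S"
    "a' \<in> borel_measurable ?O" "b' \<in> borel_measurable ?O" by auto
  have ae: "AE z in ?O. a' z = a (Upsilon z)" "AE z in ?O. b' z = b (Upsilon z)"
    unfolding a_def b_def a'_def b'_def pull_def using \<phi> f by (auto intro: U.rep_pull(2))
  have transfer: "(LINT x|?S. (b x - l * a x) * F x) = (LINT z|?O. (b' z - l * a' z) * F (Upsilon z))"
    if "F \<in> borel_measurable ?S" for F l
  proof -
    note that [measurable]
    have "(LINT x|?S. (b x - l * a x) * F x) = (LINT z|?O. (b (Upsilon z) - l * a (Upsilon z)) * F (Upsilon z))"
      by (rule U.integral_eq) measurable
    also have "\<dots> = (LINT z|?O. (b' z - l * a' z) * F (Upsilon z))"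
      using ae by (intro integral_cong_AE) auto
    finally show ?thesis .
  qed
  have solid_meas: "F \<in> borel_measurable ?S" if "F \<in> solid_harmonics k" for F k
    using that by (auto simp: solid_harmonics_def intro!: polyfun_surface_measurable homogeneous_polyfun)
  have "(\<forall>k. \<forall>F\<in>solid_harmonics k. (LINT x|?S. (b x - lam k * a x) * F x) = 0) \<longleftrightarrow>
     (\<forall>m n. \<forall>G\<in>solid_biharmonics m n. (LINT z|?O. (b' z - lam (m + n) * a' z) * cnj (G z)) = 0)"
    (is "?sphere \<longleftrightarrow> ?Omega")
  proof
    assume L: ?sphere
    show ?Omega
    proof (intro allI ballI)
      fix m n and G :: "complex ^ 'd \<Rightarrow> complex" assume "G \<in> solid_biharmonics m n"
      then have F: "(\<lambda>z. cnj (G z)) \<circ> inv Upsilon \<in> solid_harmonics (n + m)"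
        by (intro solid_biharmonics_comp_inv_Upsilon cnj_solid_biharmonics)
      then have "(LINT x|?S. (b x - lam (n + m) * a x) * ((\<lambda>z. cnj (G z)) \<circ> inv Upsilon) x) = 0"
        using L by blast
      then have "(LINT z|?O. (b' z - lam (n + m) * a' z) * ((\<lambda>z. cnj (G z)) \<circ> inv Upsilon) (Upsilon z)) = 0"
        unfolding transfer[OF solid_meas[OF F]] .
      then show "(LINT z|?O. (b' z - lam (m + n) * a' z) * cnj (G z)) = 0"
        by (simp add: inj_Upsilon add.commute)
    qed
  next
    assume R: ?Omega
    show ?sphere
    proof (intro allI ballI)
      fix k F assume F: "F \<in> (solid_harmonics k :: (real ^ ('d \<times> 2) \<Rightarrow> complex) set)"
      obtain g where g: "\<And>n. n \<le> k \<Longrightarrow> g n \<in> solid_biharmonics (k - n) n" "\<And>z. F (Upsilon z) = (\<Sum>n\<le>k. g n z)"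
        using solid_harmonics_comp_Upsilon[OF F] by blast
      have 0: "(LINT z|?O. (b' z - lam k * a' z) * g n z) = 0" if "n \<le> k" for n
        using R[rule_format, OF cnj_solid_biharmonics[OF g(1)[OF that]]] that by simp
      have "(LINT x|?S. (b x - lam k * a x) * F x) = (LINT z|?O. (\<Sum>n\<le>k. (b' z - lam k * a' z) * g n z))"
        by (simp add: transfer[OF solid_meas[OF F]] g(2) sum_distrib_left)
      also have "\<dots> = (\<Sum>n\<le>k. (LINT z|?O. (b' z - lam k * a' z) * g n z))"
        using integrable_rep g(1) by (intro Bochner_Integration.integral_sum
            kernel_space.integrable_mult[OF kernel_space_solid_biharmonics]) auto
      finally show "(LINT x|?S. (b x - lam k * a x) * F x) = 0"
        using 0 by simp
    qed
  qed
  then show ?thesis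
    unfolding a_def[symmetric] b_def[symmetric] a'_def[symmetric] b'_def[symmetric]
    by (simp only: split_paired_All prod.case sphere_conv_iff[OF integrable_rep(2,1)] Omega_conv_iff[OF integrable_rep(4,3)])
qed

theorem theorem3p2:
  fixes lam :: "real \<Rightarrow> complex"
    and p q :: ennreal
    and Lambda_star :: "((complex ^ 'd \<Rightarrow> complex) set \<times> (complex ^ 'd \<Rightarrow> complex) set) set"
    and Lambda_tilde ::
      "((real ^ ('d \<times> 2) \<Rightarrow> complex) set \<times> (real ^ ('d \<times> 2) \<Rightarrow> complex) set) set"
    and n :: nat
  assumes "CARD('d) \<ge> 2"
    and "bounded (lam ` {0..})"
    and "1 \<le> p" and "1 \<le> q"
    and "Lambda_star = Omega_multiplier (\<lambda>(m, n). lam (real (m + n))) p q"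
    and "Lambda_tilde = sphere_multiplier (\<lambda>k. lam (real k)) p q"
    and "bounded_multiplier (sigma_Omega :: (complex ^ 'd) measure) Omega_conv
           (\<lambda>(m, n). lam (real (m + n))) p q"
  shows "kolmogorov_width n (Lambda_star `` unit_ball (Lp sigma_Omega p)) (Lp sigma_Omega q)
       = kolmogorov_width n (Lambda_tilde `` unit_ball (Lp surface_measure p)) (Lp surface_measure q)
     \<and> gelfand_width n (Lambda_star `` unit_ball (Lp sigma_Omega p)) (Lp sigma_Omega q)
       = gelfand_width n (Lambda_tilde `` unit_ball (Lp surface_measure p)) (Lp surface_measure q)
     \<and> linear_width n (Lambda_star `` unit_ball (Lp sigma_Omega p)) (Lp sigma_Omega q)
       = linear_width n (Lambda_tilde `` unit_ball (Lp surface_measure p)) (Lp surface_measure q)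
     \<and> bernstein_width n (Lambda_star `` unit_ball (Lp sigma_Omega p)) (Lp sigma_Omega q)
       = bernstein_width n (Lambda_tilde `` unit_ball (Lp surface_measure p)) (Lp surface_measure q)"
proof -
  let ?S = "surface_measure :: (real ^ ('d \<times> 2)) measure" and ?O = "sigma_Omega :: (complex ^ 'd) measure"
  interpret U: measure_iso ?O ?S Upsilon by (rule measure_iso_Upsilon)
  interpret Ip: normed_sp_iso "Lp ?S p" "Lp ?O p" U.pull
    using \<open>1 \<le> p\<close> by (rule U.normed_sp_iso_pull)
  interpret Iq: normed_sp_iso "Lp ?S q" "Lp ?O q" U.pull
    using \<open>1 \<le> q\<close> by (rule U.normed_sp_iso_pull)
  have graph: "(U.pull \<phi>, U.pull f) \<in> Lambda_star \<longleftrightarrow> (\<phi>, f) \<in> Lambda_tilde" for \<phi> f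
    using multiplier_pull_iff[OF \<open>1 \<le> p\<close> \<open>1 \<le> q\<close>, of \<phi> f "\<lambda>k. lam (real k)"]
    by (auto simp: assms(5,6) Omega_multiplier_def sphere_multiplier_def multiplier_def
        Ip.vecs Iq.vecs Ip.mem_image Iq.mem_image)
  have ball: "unit_ball (Lp ?O p) = U.pull ` unit_ball (Lp ?S p)"
    by (auto simp: unit_ball_def Ip.vecs Ip.norm)
  have sub: "Lambda_tilde `` unit_ball (Lp ?S p) \<subseteq> vecs (Lp ?S q)"
    by (auto simp: assms(6) sphere_multiplier_def multiplier_def)
  have "Lambda_star `` unit_ball (Lp ?O p) = U.pull ` (Lambda_tilde `` unit_ball (Lp ?S p))"
  proof (intro equalityI subsetI)
    fix F assume "F \<in> Lambda_star `` unit_ball (Lp ?O p)"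
    then obtain \<phi> where \<phi>: "\<phi> \<in> unit_ball (Lp ?S p)" "(U.pull \<phi>, F) \<in> Lambda_star"
      by (auto simp: ball)
    moreover obtain f where "F = U.pull f"
      using surjD[OF bij_is_surj[OF U.bij_pull]] by blast
    ultimately show "F \<in> U.pull ` (Lambda_tilde `` unit_ball (Lp ?S p))"
      by (auto simp: graph)
  qed (auto simp: ball graph[symmetric])
  then show ?thesis
    using Iq.kolmogorov_width[OF sub] Iq.gelfand_width[OF sub] Iq.linear_width[OF sub]
      Iq.bernstein_width[OF sub] by simp
qed

end
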